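(* Let $(X,d)$ be a compact length space equipped with a Borel probability measure $\nu$. (i) If $(X,d,\nu)$ satisfies the Talagrand inequality $T(K)$ for some $K>0$, then it also satisfies the Poincaré inequality $P(K)$ (with the same constant $K$). (ii) Suppose that $(X,d,\nu)$ satisfies a doubling condition and a local Poincaré inequality. If $(X,d,\nu)$ satisfies the log Sobolev inequality $\mathrm{LSI}(K)$ for some $K>0$, then it also satisfies the Talagrand inequality $T(K)$ (with the same constant $K$).
   Context: $\mathrm{Lip}(X)$ denotes the set of real-valued Lipschitz functions on $X$. Write $a_+=\max(a,0)$. For $f\in C(X)$ and $x\in X$, the subgradient norm of $f$ at $x$ is $$|\nabla^- f|(x)=\limsup_{y\to x}\frac{[f(x)-f(y)]_+}{d(x,y)}.$$ $W_2(\mu_0,\mu_1)$ denotes the Wasserstein distance of order 2 between Borel probability measures on $X$: $W_2(\mu_0,\mu_1)^2=\inf_\pi\int_{X\times X}d(x,y)^2\,d\pi(x,y)$, where $\pi$ ranges over all Borel probability measures on $X\times X$ with marginals $\mu_0$ and $\mu_1$. Functional inequalities, for $K>0$: - $\mathrm{LSI}(K)$: for every $f\in\mathrm{Lip}(X)$ with $\int_X f^2\,d\nu=1$, $\int_X f^2\log(f^2)\,d\nu\le\frac{2}{K}\int_X|\nabla^- f|^2\,d\nu$. - $T(K)$: for every $F\in L^2(X,\nu)$ with $\int_X F^2\,d\nu=1$, $W_2(F^2\nu,\nu)\le\sqrt{\frac{2\int_X F^2\log(F^2)\,d\nu}{K}}$. - $P(K)$: for every $h\in\mathrm{Lip}(X)$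 with $\int_X h\,d\nu=0$, $\int_X h^2\,d\nu\le\frac1K\int_X|\nabla^- h|^2\,d\nu$. (Here $0\log 0=0$.) Doubling condition: there is a constant $C<\infty$ such that $\nu(B_{2r}(x))\le C\,\nu(B_r(x))$ for all $x\in X$ and $r>0$, where $B_r(x)$ is the open ball. Local Poincaré inequality (weak Poincaré inequality of type $(1,1)$): there are constants $\Lambda\ge1$ and $P<\infty$ such that for every $\nu$-integrable Borel function $u:X\to\mathbb{R}$, every upper gradient $g$ of $u$, every $x\in X$ and $r>0$ with $\nu(B_r(x))>0$, $$\frac{1}{\nu(B_r(x))}\int_{B_r(x)}|u-u_{x,r}|\,d\nu\le P\,r\,\frac{1}{\nu(B_{\Lambda r}(x))}\int_{B_{\Lambda r}(x)}g\,d\nu,\qquad u_{x,r}=\frac{1}{\nu(B_r(x))}\int_{B_r(x)}u\,d\nu.$$ An upper gradient of $u$ is a Borel function $g:X\to[0,\infty]$ such that $|u(\gamma(0))-u(\gamma(\ell))|\le\int_0^{\ell}g(\gamma(s))\,ds$ for every rectifiable curve $\gamma:[0,\ell]\to X$ parametrized by arclength. *)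

theory Defs
  imports "HOL-Probability.Probability"
begin

definition curve_length :: "(real \<Rightarrow> 'a::metric_space) \<Rightarrow> real \<Rightarrow> real \<Rightarrow> ennreal" where
  "curve_length \<gamma> a b =
     (SUP (n, t) \<in> {(n::nat, t::nat \<Rightarrow> real). mono_on {..n} t \<and> t 0 = a \<and> t n = b}.
        \<Sum>i<n. ennreal (dist (\<gamma> (t i)) (\<gamma> (t (Suc i)))))"

text \<open>The infimum of the empty set is \<open>\<infinity>\<close>, so any two points of a length space are joined
  by a curve of finite length.\<close>

definition length_space :: "'a::metric_space set \<Rightarrow> bool" where
  "length_space X \<longleftrightarrow> (\<forall>x\<in>X. \<forall>y\<in>X. ennreal (dist x y) =
     (INF \<gamma> \<in> {\<gamma>. path \<gamma> \<and> path_image \<gamma> \<subseteq> X \<and> pathstart \<gamma> = x \<and> pathfinish \<gamma> = y}.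
        curve_length \<gamma> 0 1))"

definition arclength_curve :: "(real \<Rightarrow> 'a::metric_space) \<Rightarrow> real \<Rightarrow> bool" where
  "arclength_curve \<gamma> l \<longleftrightarrow> 0 \<le> l \<and> continuous_on {0..l} \<gamma> \<and>
     (\<forall>s t. 0 \<le> s \<and> s \<le> t \<and> t \<le> l \<longrightarrow> curve_length \<gamma> s t = ennreal (t - s))"

definition Lip :: "('a::metric_space \<Rightarrow> real) set" where
  "Lip = {f. \<exists>L. L-lipschitz_on UNIV f}"

text \<open>The limit superior over the punctured neighbourhoods of \<open>x\<close>, taken in \<open>[0,\<infinity>]\<close>;
  hence it is \<open>0\<close> at an isolated point.\<close>

definition subgradient_norm :: "('a::metric_space \<Rightarrow> real) \<Rightarrow> 'a \<Rightarrow> ennreal" where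
  "subgradient_norm f x = Limsup (at x) (\<lambda>y. ennreal (max (f x - f y) 0 / dist x y))"

definition upper_gradient :: "('a::metric_space \<Rightarrow> real) \<Rightarrow> ('a \<Rightarrow> ennreal) \<Rightarrow> bool" where
  "upper_gradient u g \<longleftrightarrow> g \<in> borel_measurable borel \<and>
     (\<forall>\<gamma> l. arclength_curve \<gamma> l \<longrightarrow>
        ennreal \<bar>u (\<gamma> 0) - u (\<gamma> l)\<bar> \<le> (\<integral>\<^sup>+s\<in>{0..l}. g (\<gamma> s) \<partial>lborel))"

definition ext_sqrt :: "ereal \<Rightarrow> ereal" where
  "ext_sqrt a = (if a = \<infinity> then \<infinity> else ereal (sqrt (real_of_ereal a)))"

definition couplings :: "'a::metric_space measure \<Rightarrow> 'a measure \<Rightarrow> ('a \<times> 'a) measure set" where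
  "couplings \<mu>\<^sub>0 \<mu>\<^sub>1 =
     {\<pi>. prob_space \<pi> \<and> sets \<pi> = sets borel \<and> distr \<pi> borel fst = \<mu>\<^sub>0 \<and> distr \<pi> borel snd = \<mu>\<^sub>1}"

definition W\<^sub>2 :: "'a::metric_space measure \<Rightarrow> 'a measure \<Rightarrow> ereal" where
  "W\<^sub>2 \<mu>\<^sub>0 \<mu>\<^sub>1 = ext_sqrt (enn2ereal
     (INF \<pi> \<in> couplings \<mu>\<^sub>0 \<mu>\<^sub>1. \<integral>\<^sup>+z. ennreal ((dist (fst z) (snd z))\<^sup>2) \<partial>\<pi>))"

text \<open>\<open>\<integral> f\<^sup>2 log(f\<^sup>2) d\<nu>\<close> as an extended real number. On a probability space the negative part
  always has a finite integral, because \<open>t log t \<ge> -1/e\<close>; the positive part may have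
  integral \<open>\<infinity>\<close> when \<open>f\<close> is merely in \<open>L\<^sup>2\<close>. The convention \<open>0 log 0 = 0\<close> is automatic.\<close>

definition ent_sq :: "'a measure \<Rightarrow> ('a \<Rightarrow> real) \<Rightarrow> ereal" where
  "ent_sq \<nu> f =
     enn2ereal (\<integral>\<^sup>+x. ennreal ((f x)\<^sup>2 * ln ((f x)\<^sup>2)) \<partial>\<nu>)
     - enn2ereal (\<integral>\<^sup>+x. ennreal (- ((f x)\<^sup>2 * ln ((f x)\<^sup>2))) \<partial>\<nu>)"

definition LSI :: "'a::metric_space measure \<Rightarrow> real \<Rightarrow> bool" where
  "LSI \<nu> K \<longleftrightarrow> (\<forall>f\<in>Lip. (\<integral>x. (f x)\<^sup>2 \<partial>\<nu>) = 1 \<longrightarrow>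
     ent_sq \<nu> f \<le> ereal (2 / K) * enn2ereal (\<integral>\<^sup>+x. (subgradient_norm f x)\<^sup>2 \<partial>\<nu>))"

definition Talagrand :: "'a::metric_space measure \<Rightarrow> real \<Rightarrow> bool" where
  "Talagrand \<nu> K \<longleftrightarrow>
     (\<forall>F. F \<in> borel_measurable \<nu> \<and> integrable \<nu> (\<lambda>x. (F x)\<^sup>2) \<and> (\<integral>x. (F x)\<^sup>2 \<partial>\<nu>) = 1 \<longrightarrow>
        W\<^sub>2 (density \<nu> (\<lambda>x. ennreal ((F x)\<^sup>2))) \<nu> \<le> ext_sqrt (2 * ent_sq \<nu> F / ereal K))"

definition Poincare :: "'a::metric_space measure \<Rightarrow> real \<Rightarrow> bool" where
  "Poincare \<nu> K \<longleftrightarrow> (\<forall>h\<in>Lip. (\<integral>x. h x \<partial>\<nu>) = 0 \<longrightarrow>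
     ennreal (\<integral>x. (h x)\<^sup>2 \<partial>\<nu>) \<le> ennreal (1 / K) * (\<integral>\<^sup>+x. (subgradient_norm h x)\<^sup>2 \<partial>\<nu>))"

definition doubling :: "'a::metric_space measure \<Rightarrow> bool" where
  "doubling \<nu> \<longleftrightarrow>
     (\<exists>C::real. \<forall>x. \<forall>r>0. measure \<nu> (ball x (2 * r)) \<le> C * measure \<nu> (ball x r))"

definition ball_avg :: "'a::metric_space measure \<Rightarrow> ('a \<Rightarrow> real) \<Rightarrow> 'a \<Rightarrow> real \<Rightarrow> real" where
  "ball_avg \<nu> u x r = (LINT y:ball x r|\<nu>. u y) / measure \<nu> (ball x r)"

definition local_Poincare :: "'a::metric_space measure \<Rightarrow> bool" where
  "local_Poincare \<nu> \<longleftrightarrow>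
     (\<exists>\<Lambda> P :: real. 1 \<le> \<Lambda> \<and> 0 \<le> P \<and>
        (\<forall>u g x r. u \<in> borel_measurable borel \<and> integrable \<nu> u \<and> upper_gradient u g \<and>
             0 < r \<and> 0 < measure \<nu> (ball x r) \<longrightarrow>
           ennreal (ball_avg \<nu> (\<lambda>y. \<bar>u y - ball_avg \<nu> u x r\<bar>) x r)
           \<le> ennreal (P * r / measure \<nu> (ball x (\<Lambda> * r)))
              * (\<integral>\<^sup>+y\<in>ball x (\<Lambda> * r). g y \<partial>\<nu>)))"

end

theory Submission
  imports Defs
begin

text \<open>
  Both implications go through quantities that are cheap to evaluate: perturbations of \<open>\<nu>\<close> for
  the first, exponential moments of the Hopf-Lax semigroup for the second.

  \<^bold>\<open>Talagrand implies Poincare.\<close> For a Lipschitz function \<open>h\<close> of mean zero put \<open>F\<^sup>2 = 1 + \<epsilon> h\<close>. The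
  entropy of \<open>F\<^sup>2\<nu>\<close> is \<open>\<epsilon>\<^sup>2/2 \<integral> h\<^sup>2 + O(\<epsilon>\<^sup>3)\<close>, so \<open>T(K)\<close> gives a coupling \<open>\<pi>\<close> of \<open>F\<^sup>2\<nu>\<close> and \<open>\<nu>\<close> with
  \<open>\<integral> d\<^sup>2 d\<pi> \<le> \<epsilon>\<^sup>2/K \<integral> h\<^sup>2 + O(\<epsilon>\<^sup>3)\<close>. On the other hand \<open>\<epsilon> \<integral> h\<^sup>2 = \<integral> h d(F\<^sup>2\<nu>) - \<integral> h d\<nu>\<close> is the
  \<open>\<pi>\<close>-integral of \<open>h(x) - h(y)\<close>. At distances below a fixed \<open>r\<close> this difference is at most
  \<open>G\<^sub>r(x) d(x,y)\<close>, where \<open>G\<^sub>r\<close> is the steepest descent of \<open>h\<close> at scale \<open>r\<close>; at larger distances it is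
  \<open>O(d\<^sup>2)\<close>, which contributes only \<open>O(\<epsilon>\<^sup>2)\<close>. Young's inequality with the right weights and
  \<open>\<epsilon> \<rightarrow> 0\<close> yield the Poincare inequality with \<open>G\<^sub>r\<close> in place of the subgradient norm
  (\<open>Talagrand_imp_Poincare_at_scale\<close>), and \<open>G\<^sub>r\<close> decreases to the subgradient norm as \<open>r \<rightarrow> 0\<close>.

  \<^bold>\<open>Log Sobolev implies Talagrand.\<close> Let \<open>Q\<^sub>t f(x) = inf\<^sub>y f(y) + d(x,y)\<^sup>2/2t\<close>. The point is that \<open>Q\<^sub>t f\<close> is
  a subsolution of the Hamilton-Jacobi equation at every point, in the integrated form
  \<open>Q\<^sub>t\<^sub>+\<^sub>s f \<le> Q\<^sub>t f - s t/(2(t+s)) |\<nabla>\<^sup>- Q\<^sub>t f|\<^sup>2\<close> (\<open>hopf_lax_decay\<close>). Inserted into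
  \<open>Z(t) = \<integral> exp(K t Q\<^sub>t f) d\<nu>\<close> and combined with the log Sobolev inequality for \<open>exp(K t Q\<^sub>t f)\<close>, it shows
  that \<open>ln Z(t) / t\<close> grows by at most \<open>O(s\<^sup>2)\<close> over a time step \<open>s\<close> (\<open>exponential_moment_step\<close>); hence it
  is nonincreasing. Its limit at \<open>t \<rightarrow> 0\<close> is at most \<open>K \<integral> f d\<nu>\<close>, so
  \<open>ln \<integral> exp(K Q\<^sub>1 f) d\<nu> \<le> K \<integral> f d\<nu>\<close> (\<open>LSI_imp_exponential_moment_bound\<close>). By the variational inequality
  for the entropy, \<open>\<integral> Q\<^sub>1 f d\<mu> - \<integral> f d\<nu>\<close> is at most the entropy of \<open>\<mu>\<close> divided by \<open>K\<close>, and by Kantorovich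
  duality the supremum over \<open>f\<close> of the left-hand side is \<open>W\<^sub>2(\<mu>,\<nu>)\<^sup>2/2\<close>.

  \<^bold>\<open>Kantorovich duality.\<close> It enters as the absence of a duality gap, up to an arbitrarily small error: there
  are a coupling and a potential \<open>f\<close> such that half the cost exceeds \<open>\<integral> Q\<^sub>1 f d\<mu> - \<integral> f d\<nu>\<close> by little
  (\<open>kantorovich_duality_approx\<close>). After splitting the space into finitely many small cells to discretize
  \<open>\<nu>\<close>, the coupling is the solution of the entropically regularized problem: mass at \<open>x\<close> is distributed
  over the cells by softmax weights, whose parameters minimize a convex function of finitely
  many variables. Stationarity of the minimum is exactly the second marginal condition
  (\<open>softmax_marginals\<close>). The logarithm of the softmax weight relates the cost to the potentials, at the
  price of an entropy term that vanishes with the regularization.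
\<close>

section \<open>Continuous functions on a compact metric space\<close>

lemma le_if_le_plus_linear:
  fixes a b C \<delta>\<^sub>0 :: real
  assumes "0 < \<delta>\<^sub>0" and le: "\<And>\<delta>. 0 < \<delta> \<Longrightarrow> \<delta> < \<delta>\<^sub>0 \<Longrightarrow> a \<le> b + \<delta> * C"
  shows "a \<le> b"
proof (rule tendsto_lowerbound)
  show "((\<lambda>\<delta>. b + \<delta> * C) \<longlongrightarrow> b) (at_right 0)"
    by (auto intro!: tendsto_eq_intros)
  show "\<forall>\<^sub>F \<delta> in at_right 0. a \<le> b + \<delta> * C"
    unfolding eventually_at_right_field using assms by auto
qed simp

lemma compact_space_dist_bounded:
  assumes "compact (UNIV :: 'a::metric_space set)"
  obtains D where "0 < D" "\<And>x y::'a. dist x y \<le> D"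
proof -
  obtain e where e: "\<And>x y::'a. dist x y \<le> e"
    using compact_imp_bounded[OF assms] unfolding bounded_two_points by auto
  have "dist x y \<le> max e 1" for x y :: 'a
    using e[of x y] by simp
  then show thesis
    using that[of "max e 1"] by simp
qed

lemma compact_space_continuous_bounded:
  fixes f :: "'a::metric_space \<Rightarrow> real"
  assumes "compact (UNIV :: 'a set)" "continuous_on UNIV f"
  obtains B where "0 < B" "\<And>x. \<bar>f x\<bar> \<le> B"
proof -
  have "bounded (range f)"
    using compact_continuous_image[OF assms(2,1)] compact_imp_bounded by blast
  then obtain B where B: "\<And>x. \<bar>f x\<bar> \<le> B"
    unfolding bounded_iff by auto
  have "\<bar>f x\<bar> \<le> max B 1" for x
    using B[of x] by simp
  then show thesis
    using that[of "max B 1"] by simp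
qed

lemma integrable_bounded_borel:
  fixes f :: "'a::topological_space \<Rightarrow> real"
  assumes "prob_space M" "sets M = sets borel" "f \<in> borel_measurable borel" "\<And>x. \<bar>f x\<bar> \<le> B"
  shows "integrable M f"
proof -
  interpret prob_space M by fact
  have "f \<in> borel_measurable M"
    using assms(3) unfolding measurable_cong_sets[OF assms(2) refl] .
  then show ?thesis
    using assms(4) by (intro integrable_const_bound[where B=B]) auto
qed

lemma integrable_continuous_compact_space:
  fixes f :: "'a::metric_space \<Rightarrow> real"
  assumes "compact (UNIV :: 'a set)" "prob_space M" "sets M = sets borel" "continuous_on UNIV f"
  shows "integrable M f"
proof -
  obtain B where "\<And>x. \<bar>f x\<bar> \<le> B"
    using compact_space_continuous_bounded[OF assms(1,4)] by blast
  then show ?thesis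
    using assms by (intro integrable_bounded_borel[where B=B] borel_measurable_continuous_onI) auto
qed

lemma integral_exp_bounded:
  fixes g :: "'a \<Rightarrow> real"
  assumes prob: "prob_space M" and g: "g \<in> borel_measurable M" "\<And>x. \<bar>g x\<bar> \<le> B"
  shows integrable_exp_bounded: "integrable M (\<lambda>x. exp (g x))"
    and integral_exp_bounded_pos: "0 < (\<integral>x. exp (g x) \<partial>M)"
proof -
  interpret prob_space M by fact
  have [measurable]: "g \<in> borel_measurable M" by fact
  show int: "integrable M (\<lambda>x. exp (g x))"
    using g(2) by (intro integrable_const_bound[where B="exp B"]) (auto simp: abs_le_iff)
  have "(\<integral>x. exp (- B) \<partial>M) \<le> (\<integral>x. exp (g x) \<partial>M)"
    using g(2) int by (intro integral_mono) (auto simp: abs_le_iff minus_le_iff)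
  then have "exp (- B) \<le> (\<integral>x. exp (g x) \<partial>M)" by (simp add: prob_space)
  then show "0 < (\<integral>x. exp (g x) \<partial>M)"
    using exp_gt_zero[of "- B"] by linarith
qed

lemma integral_exp_pos_compact_space:
  fixes g :: "'a::metric_space \<Rightarrow> real"
  assumes "compact (UNIV :: 'a set)" "prob_space M" "sets M = sets borel" "continuous_on UNIV g"
  shows "0 < (\<integral>x. exp (g x) \<partial>M)"
proof -
  obtain B where B: "\<And>x. \<bar>g x\<bar> \<le> B"
    using compact_space_continuous_bounded[OF assms(1,4)] by blast
  have "g \<in> borel_measurable M"
    unfolding measurable_cong_sets[OF assms(3) refl]
    using assms(4) by (rule borel_measurable_continuous_onI)
  then show ?thesis
    using assms(2) B by (intro integral_exp_bounded_pos)
qed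

section \<open>The subgradient norm as a limit of slopes at a fixed scale\<close>

text \<open>
  The subgradient norm is the decreasing limit of these functions as \<open>r\<close> tends to \<open>0\<close>. At a fixed
  scale the slope is a supremum of continuous functions on open sets, hence lower semicontinuous, which
  makes the subgradient norm measurable.
\<close>

definition descending_slope :: "('a::metric_space \<Rightarrow> real) \<Rightarrow> real \<Rightarrow> 'a \<Rightarrow> ennreal" where
  "descending_slope f r x = (SUP y\<in>ball x r - {x}. ennreal (max (f x - f y) 0 / dist x y))"

lemma subgradient_norm_eq_INF:
  "subgradient_norm f x = (INF r\<in>{0<..}. descending_slope f r x)"
  unfolding subgradient_norm_def descending_slope_def by (rule Limsup_at)

lemma descending_slope_mono: "r \<le> r' \<Longrightarrow> descending_slope f r x \<le> descending_slope f r' x"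
  unfolding descending_slope_def by (rule SUP_subset_mono) auto

lemma subgradient_norm_eq_INF_sequence:
  "subgradient_norm f x = (INF n. descending_slope f (1 / real (Suc n)) x)"
  unfolding subgradient_norm_eq_INF
proof (rule INF_eq)
  fix r :: real assume "r \<in> {0<..}"
  then obtain n where "1 / real (Suc n) < r"
    using nat_approx_posE[of r] by (auto simp: inverse_eq_divide)
  then show "\<exists>n\<in>UNIV. descending_slope f (1 / real (Suc n)) x \<le> descending_slope f r x"
    by (auto intro!: exI[of _ n] descending_slope_mono)
qed (auto intro!: bexI)

lemma descending_slope_lipschitz:
  assumes "L-lipschitz_on UNIV f"
  shows "descending_slope f r x \<le> ennreal L"
  unfolding descending_slope_def
proof (rule SUP_least)
  fix y assume y: "y \<in> ball x r - {x}"
  have "f x - f y \<le> L * dist x y" "0 \<le> L * dist x y"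
    using lipschitz_onD[OF assms, of x y] lipschitz_on_nonneg[OF assms] by (auto simp: dist_real_def)
  then show "ennreal (max (f x - f y) 0 / dist x y) \<le> ennreal L"
    using y by (intro ennreal_leI) (auto simp: divide_le_eq)
qed

lemma subgradient_norm_le_descending_slope:
  "0 < r \<Longrightarrow> subgradient_norm f x \<le> descending_slope f r x"
  unfolding subgradient_norm_eq_INF by (rule INF_lower) auto

lemma subgradient_norm_lipschitz:
  "L-lipschitz_on UNIV f \<Longrightarrow> subgradient_norm f x \<le> ennreal L"
  using subgradient_norm_le_descending_slope[of 1 f x] descending_slope_lipschitz[of L f 1 x]
  by simp

lemma subgradient_norm_eq_ennreal:
  "L-lipschitz_on UNIV f \<Longrightarrow> subgradient_norm f x = ennreal (enn2real (subgradient_norm f x))"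
  using le_less_trans[OF subgradient_norm_lipschitz ennreal_less_top, of L f x]
  by (simp add: less_top)

text \<open>
  This serves as the chain rule \<open>|\<nabla>\<^sup>- \<Phi>(v)| \<le> \<Phi>'(v) |\<nabla>\<^sup>- v|\<close> for increasing \<open>\<Phi>\<close>.
\<close>

lemma subgradient_norm_comparison:
  assumes c: "0 < c" and le: "\<And>y. max (w x - w y) 0 \<le> c * max (v x - v y) 0"
  shows "subgradient_norm w x \<le> ennreal c * subgradient_norm v x"
proof -
  have "subgradient_norm w x / ennreal c \<le> subgradient_norm v x"
    unfolding subgradient_norm_eq_INF[of v]
  proof (rule INF_greatest)
    fix r :: real assume r: "r \<in> {0<..}"
    have "descending_slope w r x \<le> descending_slope v r x * ennreal c"
      unfolding descending_slope_def
    proof (rule SUP_least)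
      fix y assume y: "y \<in> ball x r - {x}"
      have "max (w x - w y) 0 / dist x y \<le> max (v x - v y) 0 / dist x y * c"
        using le[of y] y by (simp add: divide_right_mono mult.commute)
      then have "ennreal (max (w x - w y) 0 / dist x y) \<le> ennreal (max (v x - v y) 0 / dist x y) * ennreal c"
        using c by (subst ennreal_mult''[symmetric]) (auto intro: ennreal_leI)
      also have "\<dots> \<le> (SUP y\<in>ball x r - {x}. ennreal (max (v x - v y) 0 / dist x y)) * ennreal c"
        using y by (intro mult_right_mono SUP_upper) auto
      finally show "ennreal (max (w x - w y) 0 / dist x y)
        \<le> (SUP y\<in>ball x r - {x}. ennreal (max (v x - v y) 0 / dist x y)) * ennreal c" .
    qed
    then have "subgradient_norm w x \<le> descending_slope v r x * ennreal c"
      using subgradient_norm_le_descending_slope[of r w x] r by (auto intro: order_trans)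
    then show "subgradient_norm w x / ennreal c \<le> descending_slope v r x"
      using c by (intro divide_le_posI_ennreal) (auto simp: mult.commute)
  qed
  then have "subgradient_norm w x / ennreal c * ennreal c \<le> subgradient_norm v x * ennreal c"
    by (rule mult_right_mono) simp
  moreover have "subgradient_norm w x / ennreal c * ennreal c = subgradient_norm w x"
    using c by (simp add: ennreal_divide_times)
  ultimately show ?thesis
    by (simp add: mult.commute)
qed

lemma descending_slope_measurable:
  fixes f :: "'a::metric_space \<Rightarrow> real"
  assumes "continuous_on UNIV f"
  shows "descending_slope f r \<in> borel_measurable borel"
proof (rule borel_measurableI_greater)
  fix a
  let ?q = "\<lambda>y x. ennreal (max (f x - f y) 0 / dist x y)"
  have "{x. a < descending_slope f r x} = (\<Union>y. (ball y r - {y}) \<inter> ?q y -` {a<..})"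
    by (auto simp: descending_slope_def less_SUP_iff dist_commute)
  moreover have "open ((ball y r - {y}) \<inter> ?q y -` {a<..})" for y
  proof (rule continuous_open_preimage)
    show "continuous_on (ball y r - {y}) (?q y)"
      using continuous_on_subset[OF assms, of "ball y r - {y}"]
      by (intro continuous_on_ennreal continuous_on_divide continuous_intros) auto
  qed auto
  ultimately have "open {x. a < descending_slope f r x}"
    by (simp add: open_UN)
  then show "{x \<in> space borel. a < descending_slope f r x} \<in> sets borel"
    by simp
qed

lemma subgradient_norm_measurable:
  fixes f :: "'a::metric_space \<Rightarrow> real"
  assumes "continuous_on UNIV f"
  shows "subgradient_norm f \<in> borel_measurable borel"
proof -
  have [measurable]: "descending_slope f r \<in> borel_measurable borel" for r
    using assms by (rule descending_slope_measurable)
  show ?thesis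
    unfolding subgradient_norm_eq_INF_sequence[abs_def] by measurable
qed

section \<open>The Hopf-Lax semigroup\<close>

definition hopf_lax :: "real \<Rightarrow> ('a::metric_space \<Rightarrow> real) \<Rightarrow> 'a \<Rightarrow> real" where
  "hopf_lax t f x = (INF y. f y + (dist x y)\<^sup>2 / (2 * t))"

context
  fixes f :: "'a::metric_space \<Rightarrow> real" and t :: real
  assumes compact: "compact (UNIV :: 'a set)"
    and cont: "continuous_on UNIV f"
    and t_pos: "0 < t"
begin

lemma hopf_lax_attained: obtains y where "hopf_lax t f x = f y + (dist x y)\<^sup>2 / (2 * t)"
proof -
  have "continuous_on UNIV (\<lambda>y. f y + (dist x y)\<^sup>2 / (2 * t))"
    using cont t_pos by (auto intro!: continuous_intros)
  then obtain y where y: "\<And>z. f y + (dist x y)\<^sup>2 / (2 * t) \<le> f z + (dist x z)\<^sup>2 / (2 * t)"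
    using continuous_attains_inf[OF compact] by auto
  have "hopf_lax t f x = f y + (dist x y)\<^sup>2 / (2 * t)"
    unfolding hopf_lax_def by (rule cInf_eq_minimum) (use y in auto)
  with that show thesis .
qed

lemma hopf_lax_le: "hopf_lax t f x \<le> f y + (dist x y)\<^sup>2 / (2 * t)"
proof -
  obtain B where B: "\<And>x. \<bar>f x\<bar> \<le> B"
    using compact_space_continuous_bounded[OF compact cont] by blast
  show ?thesis
    unfolding hopf_lax_def
  proof (rule cINF_lower)
    show "bdd_below (range (\<lambda>y. f y + (dist x y)\<^sup>2 / (2 * t)))"
    proof (rule bdd_belowI[of _ "- B"])
      fix w assume "w \<in> range (\<lambda>y. f y + (dist x y)\<^sup>2 / (2 * t))"
      then obtain y where "w = f y + (dist x y)\<^sup>2 / (2 * t)" by auto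
      moreover have "0 \<le> (dist x y)\<^sup>2 / (2 * t)" using t_pos by simp
      ultimately show "- B \<le> w" using B[of y] by linarith
    qed
  qed simp
qed

lemma hopf_lax_le_self: "hopf_lax t f x \<le> f x"
  using hopf_lax_le[of x x] by simp

lemma hopf_lax_bounded:
  assumes "\<And>x. \<bar>f x\<bar> \<le> B"
  shows "\<bar>hopf_lax t f x\<bar> \<le> B"
proof -
  obtain y where y: "hopf_lax t f x = f y + (dist x y)\<^sup>2 / (2 * t)"
    by (rule hopf_lax_attained)
  have "0 \<le> (dist x y)\<^sup>2 / (2 * t)" using t_pos by simp
  then show ?thesis
    using y assms[of x] assms[of y] hopf_lax_le_self[of x] by linarith
qed

lemma hopf_lax_lipschitz:
  assumes D: "\<And>x y::'a. dist x y \<le> D"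
  shows "(D / t)-lipschitz_on UNIV (hopf_lax t f)"
proof (rule lipschitz_onI)
  have *: "hopf_lax t f x - hopf_lax t f y \<le> D / t * dist x y" for x y
  proof -
    obtain z where z: "hopf_lax t f y = f z + (dist y z)\<^sup>2 / (2 * t)"
      by (rule hopf_lax_attained)
    have "(dist x z)\<^sup>2 - (dist y z)\<^sup>2 = (dist x z - dist y z) * (dist x z + dist y z)"
      by (simp add: power2_eq_square algebra_simps)
    also have "\<dots> \<le> dist x y * (2 * D)"
      using D[of x z] D[of y z] dist_triangle[of x z y]
      by (intro mult_mono) auto
    finally have "((dist x z)\<^sup>2 - (dist y z)\<^sup>2) / (2 * t) \<le> dist x y * (2 * D) / (2 * t)"
      using t_pos by (intro divide_right_mono) auto
    then show ?thesis
      using hopf_lax_le[of x z] z by (simp add: diff_divide_distrib mult.commute)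
  qed
  show "dist (hopf_lax t f x) (hopf_lax t f y) \<le> D / t * dist x y" for x y
    using *[of x y] *[of y x] by (simp add: dist_real_def dist_commute abs_le_iff)
  show "0 \<le> D / t"
    using t_pos D[of undefined undefined] by simp
qed

lemma hopf_lax_continuous: "continuous_on UNIV (hopf_lax t f)"
  by (meson compact compact_space_dist_bounded hopf_lax_lipschitz lipschitz_on_continuous_on)

end

text \<open>
  Write \<open>u = Q\<^sub>t f\<close>. Along points \<open>y\<close> near \<open>x\<close> where \<open>u\<close> descends with slope more than \<open>c\<close>, a minimizer
  \<open>z\<close> for \<open>u(y)\<close> lies at distance at least about \<open>t c\<close>: comparing \<open>z\<close> as a competitor for \<open>u(x)\<close> gives
  \<open>c d(x,y) < (d(x,z)\<^sup>2 - d(y,z)\<^sup>2)/2t\<close>, whose right-hand side is at most about \<open>d(x,y) d(y,z)/t\<close>. Using the same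
  \<open>z\<close> as a competitor at time \<open>t + s\<close> replaces \<open>d\<^sup>2/2t\<close> by \<open>d\<^sup>2/2(t+s)\<close>, a gain of
  \<open>s d\<^sup>2/(2t(t+s)) \<ge> s t c\<^sup>2/(2(t+s))\<close>. Letting \<open>y\<close> tend to \<open>x\<close> and then \<open>c\<close> to the subgradient norm of
  \<open>u\<close> at \<open>x\<close> gives the claim.
\<close>

lemma hopf_lax_decay:
  fixes f :: "'a::metric_space \<Rightarrow> real"
  assumes compact: "compact (UNIV :: 'a set)" and cont: "continuous_on UNIV f"
    and t: "0 < t" and s: "0 \<le> s"
  defines "G \<equiv> \<lambda>x. enn2real (subgradient_norm (hopf_lax t f) x)"
  shows "hopf_lax (t + s) f x \<le> hopf_lax t f x - s * t * (G x)\<^sup>2 / (2 * (t + s))"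
proof -
  define u where "u = hopf_lax t f"
  obtain D where D: "0 < D" "\<And>x y::'a. dist x y \<le> D"
    using compact_space_dist_bounded[OF compact] by blast
  have less: "hopf_lax (t + s) f x \<le> u x - s * t * c\<^sup>2 / (2 * (t + s))"
    if c: "0 \<le> c" "ennreal c < subgradient_norm u x" for c
  proof (rule le_if_le_plus_linear[of 1 _ _ "(s * c + 2 * D + 1) / (2 * (t + s))"])
    fix \<delta> :: real assume \<delta>: "0 < \<delta>" "\<delta> < 1"
    have "ennreal c < descending_slope u \<delta> x"
      using c(2) subgradient_norm_le_descending_slope[OF \<delta>(1), of u x] by simp
    then obtain y where "y \<in> ball x \<delta> - {x}" and y3: "ennreal c < ennreal (max (u x - u y) 0 / dist x y)"
      unfolding descending_slope_def less_SUP_iff by blast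
    then have y: "dist x y < \<delta>" "y \<noteq> x" by auto
    have "c < max (u x - u y) 0 / dist x y"
      using y3 c(1) by (simp add: ennreal_less_iff)
    then have slope: "c * dist x y < max (u x - u y) 0"
      using y(2) by (simp add: pos_less_divide_eq)
    moreover have "0 \<le> c * dist x y" using c by simp
    ultimately have uy: "u y \<le> u x" and slope: "c * dist x y < u x - u y" by linarith+
    obtain z where z: "u y = f z + (dist y z)\<^sup>2 / (2 * t)"
      unfolding u_def by (rule hopf_lax_attained[OF compact cont t])
    define b where "b = dist y z"
    have xz: "dist x z \<le> b + dist x y"
      using dist_triangle[of x z y] by (simp add: b_def)
    have "u x \<le> f z + (dist x z)\<^sup>2 / (2 * t)"
      unfolding u_def by (rule hopf_lax_le[OF compact cont t])
    with slope z have "c * dist x y < ((dist x z)\<^sup>2 - b\<^sup>2) / (2 * t)"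
      by (simp add: b_def diff_divide_distrib)
    then have "c * dist x y * (2 * t) < (dist x z)\<^sup>2 - b\<^sup>2"
      using t by (simp add: pos_less_divide_eq)
    also have "\<dots> \<le> (b + dist x y)\<^sup>2 - b\<^sup>2"
      using xz by (simp add: power_mono)
    also have "\<dots> = dist x y * (2 * b + dist x y)"
      by (simp add: power2_eq_square algebra_simps)
    finally have "dist x y * (2 * t * c) < dist x y * (2 * b + dist x y)"
      by (simp add: mult_ac)
    then have "2 * t * c < 2 * b + dist x y"
      using y(2) by simp
    then have "t * c - \<delta> / 2 \<le> b"
      using y(1) by simp
    \<comment> \<open>The tangent to the square at \<open>t c\<close>.\<close>
    then have "(t * c)\<^sup>2 - t * c * \<delta> \<le> 2 * (t * c) * b - (t * c)\<^sup>2"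
      using mult_left_mono[of "t * c - \<delta> / 2" b "2 * (t * c)"] t c
      by (simp add: power2_eq_square algebra_simps)
    also have "\<dots> \<le> b\<^sup>2"
      using zero_le_power2[of "b - t * c"] by (simp add: power2_eq_square algebra_simps)
    finally have b2: "(t * c)\<^sup>2 - t * c * \<delta> \<le> b\<^sup>2" .
    have "(dist x z)\<^sup>2 \<le> (b + \<delta>)\<^sup>2"
      using xz y(1) by (intro power_mono) auto
    also have "\<dots> = b\<^sup>2 + \<delta> * (2 * b + \<delta>)"
      by (simp add: power2_eq_square algebra_simps)
    also have "\<dots> \<le> b\<^sup>2 + \<delta> * (2 * D + 1)"
      using D(2)[of y z] \<delta> by (simp add: b_def)
    finally have xz2: "(dist x z)\<^sup>2 \<le> b\<^sup>2 + \<delta> * (2 * D + 1)" .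
    have "hopf_lax (t + s) f x \<le> f z + (dist x z)\<^sup>2 / (2 * (t + s))"
      using s t by (intro hopf_lax_le[OF compact cont]) auto
    also have "\<dots> \<le> f z + (b\<^sup>2 + \<delta> * (2 * D + 1)) / (2 * (t + s))"
      using xz2 s t by (intro add_left_mono divide_right_mono) auto
    also have "\<dots> = u y - s / (2 * t * (t + s)) * b\<^sup>2 + \<delta> * (2 * D + 1) / (2 * (t + s))"
    proof -
      have "b\<^sup>2 / (2 * (t + s)) = b\<^sup>2 / (2 * t) - s / (2 * t * (t + s)) * b\<^sup>2"
        using s t by (simp add: divide_simps) (simp add: algebra_simps)
      then show ?thesis
        using z by (simp add: b_def add_divide_distrib)
    qed
    also have "\<dots> \<le> u x - s / (2 * t * (t + s)) * ((t * c)\<^sup>2 - t * c * \<delta>)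
        + \<delta> * (2 * D + 1) / (2 * (t + s))"
      using uy b2 s t by (intro add_mono diff_mono mult_left_mono) auto
    also have "\<dots> = u x - s * t * c\<^sup>2 / (2 * (t + s)) + \<delta> * ((s * c + 2 * D + 1) / (2 * (t + s)))"
    proof -
      have "s / (2 * t * (t + s)) * ((t * c)\<^sup>2 - t * c * \<delta>)
          = s * t * c\<^sup>2 / (2 * (t + s)) - \<delta> * (s * c) / (2 * (t + s))"
        using s t by (simp add: divide_simps) (simp add: algebra_simps power2_eq_square)
      then show ?thesis
        by (simp add: add_divide_distrib distrib_left)
    qed
    finally show "hopf_lax (t + s) f x
      \<le> u x - s * t * c\<^sup>2 / (2 * (t + s)) + \<delta> * ((s * c + 2 * D + 1) / (2 * (t + s)))" .
  qed simp
  have lip: "(D / t)-lipschitz_on UNIV u"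
    unfolding u_def using D(2) by (rule hopf_lax_lipschitz[OF compact cont t])
  have fin: "subgradient_norm u x = ennreal (G x)"
    unfolding G_def u_def[symmetric] by (rule subgradient_norm_eq_ennreal[OF lip])
  show ?thesis
  proof (cases "G x = 0")
    case True
    obtain z where z: "u x = f z + (dist x z)\<^sup>2 / (2 * t)"
      unfolding u_def by (rule hopf_lax_attained[OF compact cont t])
    have "hopf_lax (t + s) f x \<le> f z + (dist x z)\<^sup>2 / (2 * (t + s))"
      using s t by (intro hopf_lax_le[OF compact cont]) auto
    also have "\<dots> \<le> u x"
      unfolding z using s t by (intro add_left_mono divide_left_mono) auto
    finally show ?thesis
      using True by (simp add: u_def)
  next
    case False
    then have G: "0 < G x" by (simp add: G_def order_less_le)
    have "((\<lambda>c. u x - s * t * c\<^sup>2 / (2 * (t + s))) \<longlongrightarrow> u x - s * t * (G x)\<^sup>2 / (2 * (t + s))) (at_left (G x))"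
      using s t by (auto intro!: tendsto_intros)
    moreover have "\<forall>\<^sub>F c in at_left (G x). hopf_lax (t + s) f x \<le> u x - s * t * c\<^sup>2 / (2 * (t + s))"
      unfolding eventually_at_left_field
    proof (intro exI[of _ 0] conjI allI impI G)
      fix c assume "0 < c" "c < G x"
      then show "hopf_lax (t + s) f x \<le> u x - s * t * c\<^sup>2 / (2 * (t + s))"
        using fin by (intro less) (auto simp: ennreal_less_iff)
    qed
    ultimately show ?thesis
      unfolding u_def[symmetric] by (rule tendsto_lowerbound) simp
  qed
qed

section \<open>Exponential moments along the Hopf-Lax semigroup\<close>

lemma ent_sq_eq_integral:
  assumes "integrable M (\<lambda>x. (F x)\<^sup>2 * ln ((F x)\<^sup>2))"
  shows "ent_sq M F = ereal (\<integral>x. (F x)\<^sup>2 * ln ((F x)\<^sup>2) \<partial>M)"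
proof -
  let ?p = "\<integral>\<^sup>+x. ennreal ((F x)\<^sup>2 * ln ((F x)\<^sup>2)) \<partial>M"
  let ?n = "\<integral>\<^sup>+x. ennreal (- ((F x)\<^sup>2 * ln ((F x)\<^sup>2))) \<partial>M"
  obtain p n where pn: "?p = ennreal p" "0 \<le> p" "?n = ennreal n" "0 \<le> n"
    using integrableD(2,3)[OF assms] by (cases ?p; cases ?n) auto
  then show ?thesis
    unfolding ent_sq_def real_lebesgue_integral_def[OF assms] pn
    by (simp add: enn2ereal_ennreal)
qed

lemma exp_le_quadratic:
  fixes x :: real
  assumes "x \<le> 1"
  shows "exp x \<le> 1 + x + x\<^sup>2"
proof (cases "0 \<le> x")
  case True
  then show ?thesis using exp_bound[of x] assms by simp
next
  case False
  define y where "y = - x"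
  have y: "0 < y" using False by (simp add: y_def)
  have pos: "0 < 1 - y + y\<^sup>2"
    using zero_le_power2[of "y - 1/2"] by (simp add: power2_eq_square algebra_simps)
  have "1 \<le> (1 - y + y\<^sup>2) * (1 + y + y\<^sup>2 / 2)"
  proof -
    have "(1 - y + y\<^sup>2) * (1 + y + y\<^sup>2 / 2) = 1 + y\<^sup>2 / 2 + y ^ 3 / 2 + y ^ 4 / 2"
      by (simp add: power2_eq_square power3_eq_cube power4_eq_xxxx field_simps)
    then show ?thesis using y by simp
  qed
  also have "\<dots> \<le> (1 - y + y\<^sup>2) * exp y"
    using exp_lower_Taylor_quadratic[of y] y pos by (intro mult_left_mono) auto
  finally have "exp (- y) \<le> (1 - y + y\<^sup>2) * exp y * exp (- y)"
    using mult_right_mono[of 1 "(1 - y + y\<^sup>2) * exp y" "exp (- y)"] by simp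
  also have "\<dots> = 1 - y + y\<^sup>2"
    by (simp add: exp_minus)
  finally show ?thesis by (simp add: y_def)
qed

lemma exp_diff_le:
  fixes a b :: real
  shows "max (exp a - exp b) 0 \<le> exp a * max (a - b) 0"
proof (cases "b \<le> a")
  case True
  have "exp a - exp b = exp a * (1 - exp (b - a))"
    by (simp add: right_diff_distrib exp_diff)
  also have "\<dots> \<le> exp a * (a - b)"
    using exp_ge_add_one_self[of "b - a"] by (intro mult_left_mono) (linarith, simp)
  finally show ?thesis using True by simp
qed simp

text \<open>
  The log Sobolev inequality for \<open>f = exp(v/2) / sqrt Z\<close>, where \<open>|\<nabla>\<^sup>- f| \<le> f |\<nabla>\<^sup>- v| / 2\<close>.
\<close>

lemma LSI_exponential:
  fixes \<nu> :: "'a::metric_space measure"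
  assumes compact: "compact (UNIV :: 'a set)" and prob: "prob_space \<nu>" and sets: "sets \<nu> = sets borel"
    and K: "0 < K" and LSI: "LSI \<nu> K" and v: "L-lipschitz_on UNIV v"
  defines "G \<equiv> \<lambda>x. enn2real (subgradient_norm v x)"
  defines "Z \<equiv> \<integral>x. exp (v x) \<partial>\<nu>"
  shows "(\<integral>x. v x * exp (v x) \<partial>\<nu>) - Z * ln Z \<le> 1 / (2 * K) * (\<integral>x. (G x)\<^sup>2 * exp (v x) \<partial>\<nu>)"
proof -
  interpret prob_space \<nu> by fact
  have cont: "continuous_on UNIV v"
    using v by (rule lipschitz_on_continuous_on)
  obtain B where B: "\<And>x. \<bar>v x\<bar> \<le> B"
    using compact_space_continuous_bounded[OF compact cont] by blast
  note int = integrable_continuous_compact_space[OF compact prob sets]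
  have int_exp: "integrable \<nu> (\<lambda>x. exp (v x))"
    and int_vexp: "integrable \<nu> (\<lambda>x. v x * exp (v x))"
    by (auto intro!: int continuous_intros cont)
  have Z: "0 < Z"
    unfolding Z_def by (rule integral_exp_pos_compact_space[OF compact prob sets cont])
  define f where "f x = exp (v x / 2) / sqrt Z" for x
  have f_sq: "(f x)\<^sup>2 = exp (v x) / Z" for x
    using Z by (simp add: f_def power_divide flip: exp_double)
  have f_pos: "0 < f x" for x
    using Z by (simp add: f_def)
  have f_slope: "max (f x - f y) 0 \<le> (f x / 2) * max (v x - v y) 0" for x y
  proof -
    have "max (f x - f y) 0 = max (exp (v x / 2) - exp (v y / 2)) 0 / sqrt Z"
      using Z by (simp add: f_def max_def diff_divide_distrib divide_le_0_iff flip: diff_divide_distrib)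
    also have "\<dots> \<le> exp (v x / 2) * max (v x / 2 - v y / 2) 0 / sqrt Z"
      using Z by (intro divide_right_mono exp_diff_le) auto
    also have "\<dots> = (f x / 2) * max (v x - v y) 0"
    proof -
      have "max (v x / 2 - v y / 2) 0 = max (v x - v y) 0 / 2"
        by (simp add: max_def)
      show ?thesis unfolding f_def \<open>max (v x / 2 - v y / 2) 0 = max (v x - v y) 0 / 2\<close> by simp
    qed
    finally show ?thesis .
  qed
  have f_Lip: "f \<in> Lip"
  proof -
    have f_le: "f x \<le> exp (B / 2) / sqrt Z" for x
      using B[of x] Z by (simp add: f_def divide_right_mono)
    have L: "0 \<le> L" using v by (rule lipschitz_on_nonneg)
    have one_sided: "f x - f y \<le> exp (B / 2) / sqrt Z / 2 * L * dist x y" for x y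
    proof -
      have "f x - f y \<le> (f x / 2) * max (v x - v y) 0"
        using f_slope[of x y] by (rule order_trans[rotated]) simp
      also have "\<dots> \<le> (exp (B / 2) / sqrt Z / 2) * (L * dist x y)"
        using f_le[of x] f_pos[of x] lipschitz_onD[OF v, of x y] L Z
        by (intro mult_mono) (auto simp: dist_real_def)
      finally show ?thesis by (simp add: mult.assoc)
    qed
    have "(exp (B / 2) / sqrt Z / 2 * L)-lipschitz_on UNIV f"
    proof (rule lipschitz_onI)
      show "dist (f x) (f y) \<le> exp (B / 2) / sqrt Z / 2 * L * dist x y" for x y
        using one_sided[of x y] one_sided[of y x] by (simp add: dist_real_def dist_commute abs_le_iff)
      show "0 \<le> exp (B / 2) / sqrt Z / 2 * L" using L Z by simp
    qed
    then show ?thesis by (auto simp: Lip_def)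
  qed
  have G: "subgradient_norm v x = ennreal (G x)" for x
    unfolding G_def by (rule subgradient_norm_eq_ennreal[OF v])
  have G_nonneg: "0 \<le> G x" for x by (simp add: G_def)
  have G_le: "G x \<le> L" for x
    unfolding G_def
    using subgradient_norm_lipschitz[OF v, of x] lipschitz_on_nonneg[OF v] by (rule enn2real_leI[rotated])
  have [measurable]: "subgradient_norm v \<in> borel_measurable borel" "v \<in> borel_measurable borel"
    using cont by (auto intro: subgradient_norm_measurable borel_measurable_continuous_onI)
  have int_G: "integrable \<nu> (\<lambda>x. (G x)\<^sup>2 * exp (v x))"
  proof (rule integrable_bounded_borel[OF prob sets])
    show "(\<lambda>x. (G x)\<^sup>2 * exp (v x)) \<in> borel_measurable borel"
      unfolding G_def by measurable
    show "\<bar>(G x)\<^sup>2 * exp (v x)\<bar> \<le> L\<^sup>2 * exp B" for x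
      using G_le[of x] G_nonneg[of x] B[of x] by (auto simp: abs_mult intro!: mult_mono power_mono)
  qed
  have ent_integrand: "(f x)\<^sup>2 * ln ((f x)\<^sup>2) = (v x * exp (v x) - ln Z * exp (v x)) / Z" for x
    unfolding f_sq using Z by (simp add: ln_div field_simps)
  have "ent_sq \<nu> f = ereal (\<integral>x. (f x)\<^sup>2 * ln ((f x)\<^sup>2) \<partial>\<nu>)"
    by (rule ent_sq_eq_integral) (use int_exp int_vexp in \<open>auto simp: ent_integrand\<close>)
  also have "(\<integral>x. (f x)\<^sup>2 * ln ((f x)\<^sup>2) \<partial>\<nu>) = ((\<integral>x. v x * exp (v x) \<partial>\<nu>) - Z * ln Z) / Z"
    unfolding ent_integrand using int_exp int_vexp by (simp add: Z_def mult.commute)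
  finally have ent: "ent_sq \<nu> f = ereal (((\<integral>x. v x * exp (v x) \<partial>\<nu>) - Z * ln Z) / Z)" .
  have "(\<integral>\<^sup>+x. (subgradient_norm f x)\<^sup>2 \<partial>\<nu>) \<le> (\<integral>\<^sup>+x. ennreal ((G x)\<^sup>2 * exp (v x) / (4 * Z)) \<partial>\<nu>)"
  proof (rule nn_integral_mono)
    fix x
    have "subgradient_norm f x \<le> ennreal (f x / 2) * ennreal (G x)"
      unfolding G[symmetric] using f_pos f_slope by (intro subgradient_norm_comparison) auto
    also have "\<dots> = ennreal (f x / 2 * G x)"
      using f_pos[of x] G_nonneg[of x] by (intro ennreal_mult[symmetric]) auto
    finally have "(subgradient_norm f x)\<^sup>2 \<le> (ennreal (f x / 2 * G x))\<^sup>2"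
      by (intro power_mono) auto
    also have "\<dots> = ennreal ((f x / 2 * G x)\<^sup>2)"
      using f_pos[of x] G_nonneg[of x] by (simp add: ennreal_power)
    also have "(f x / 2 * G x)\<^sup>2 = (G x)\<^sup>2 * exp (v x) / (4 * Z)"
      by (simp add: power_mult_distrib power_divide f_sq mult.commute)
    finally show "(subgradient_norm f x)\<^sup>2 \<le> ennreal ((G x)\<^sup>2 * exp (v x) / (4 * Z))" .
  qed
  also have "\<dots> = ennreal ((\<integral>x. (G x)\<^sup>2 * exp (v x) \<partial>\<nu>) / (4 * Z))"
    using int_G Z by (subst nn_integral_eq_integral) auto
  finally have grad: "enn2ereal (\<integral>\<^sup>+x. (subgradient_norm f x)\<^sup>2 \<partial>\<nu>)
      \<le> ereal ((\<integral>x. (G x)\<^sup>2 * exp (v x) \<partial>\<nu>) / (4 * Z))"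
    unfolding less_eq_ennreal.rep_eq
    by (subst (asm) enn2ereal_ennreal) (use Z in \<open>auto intro!: divide_nonneg_nonneg integral_nonneg\<close>)
  have "(\<integral>x. (f x)\<^sup>2 \<partial>\<nu>) = 1"
    unfolding f_sq using Z by (simp add: Z_def)
  then have "ent_sq \<nu> f \<le> ereal (2 / K) * enn2ereal (\<integral>\<^sup>+x. (subgradient_norm f x)\<^sup>2 \<partial>\<nu>)"
    using LSI f_Lip by (auto simp: LSI_def)
  also have "\<dots> \<le> ereal (2 / K) * ereal ((\<integral>x. (G x)\<^sup>2 * exp (v x) \<partial>\<nu>) / (4 * Z))"
    using grad K by (intro ereal_mult_left_mono) auto
  finally have "((\<integral>x. v x * exp (v x) \<partial>\<nu>) - Z * ln Z) / Z
      \<le> 2 / K * ((\<integral>x. (G x)\<^sup>2 * exp (v x) \<partial>\<nu>) / (4 * Z))"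
    unfolding ent by simp
  then have "((\<integral>x. v x * exp (v x) \<partial>\<nu>) - Z * ln Z) / Z * Z
      \<le> 2 / K * ((\<integral>x. (G x)\<^sup>2 * exp (v x) \<partial>\<nu>) / (4 * Z)) * Z"
    using Z by (intro mult_right_mono) auto
  moreover have "2 / K * (I / (4 * Z)) * Z = 1 / (2 * K) * I" "J / Z * Z = J" for I J
    using Z by simp_all
  ultimately show ?thesis by simp
qed

text \<open>
  Over \<open>n\<close> equal steps the errors add up to \<open>n O(1/n\<^sup>2)\<close>, which tends to \<open>0\<close>.
\<close>

lemma antimono_if_quadratic_increment:
  fixes \<phi> :: "real \<Rightarrow> real"
  assumes ab: "a < b" and s0: "0 < s\<^sub>0"
    and step: "\<And>t s. a \<le> t \<Longrightarrow> 0 \<le> s \<Longrightarrow> s \<le> s\<^sub>0 \<Longrightarrow> \<phi> (t + s) \<le> \<phi> t + C * s\<^sup>2"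
  shows "\<phi> b \<le> \<phi> a"
proof (rule tendsto_lowerbound)
  show "((\<lambda>n. \<phi> a + (b - a)\<^sup>2 * C * inverse (real n)) \<longlongrightarrow> \<phi> a) sequentially"
    using tendsto_add[OF tendsto_const tendsto_mult[OF tendsto_const lim_inverse_n],
        of "\<phi> a" "(b - a)\<^sup>2 * C"] by simp
  show "\<forall>\<^sub>F n in sequentially. \<phi> b \<le> \<phi> a + (b - a)\<^sup>2 * C * inverse (real n)"
  proof (rule eventually_sequentiallyI)
    fix n assume "nat \<lceil>(b - a) / s\<^sub>0\<rceil> + 1 \<le> n"
    then have n: "0 < n" and "(b - a) / s\<^sub>0 \<le> real n" by linarith+
    define s where "s = (b - a) / real n"
    have s: "0 \<le> s" "s \<le> s\<^sub>0"
      using \<open>(b - a) / s\<^sub>0 \<le> real n\<close> n ab s0 by (simp_all add: s_def field_simps)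
    have "\<phi> (a + real k * s) \<le> \<phi> a + real k * (C * s\<^sup>2)" for k
    proof (induction k)
      case (Suc k)
      have "\<phi> ((a + real k * s) + s) \<le> \<phi> (a + real k * s) + C * s\<^sup>2"
        using s by (intro step) auto
      with Suc show ?case by (simp add: algebra_simps)
    qed simp
    moreover have "real n * s = b - a" "real n * (C * s\<^sup>2) = (b - a)\<^sup>2 * C * inverse (real n)"
      using n by (simp_all add: s_def power2_eq_square inverse_eq_divide)
    ultimately show "\<phi> b \<le> \<phi> a + (b - a)\<^sup>2 * C * inverse (real n)"
      by (metis add.commute diff_add_cancel)
  qed
qed simp

text \<open>
  By \<open>hopf_lax_decay\<close>, \<open>exp(K (t+s) Q\<^sub>t\<^sub>+\<^sub>s f) \<le> exp(K t u) exp(K s w)\<close> with \<open>u = Q\<^sub>t f\<close> and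
  \<open>w = u - t |\<nabla>\<^sup>- u|\<^sup>2 / 2\<close>. The log Sobolev inequality for \<open>exp(K t u)\<close> says precisely that
  \<open>t K \<integral> w exp(K t u) d\<nu> \<le> Z ln Z\<close>, so the first-order term of the expansion in \<open>s\<close> is the one that leaves
  \<open>ln Z(t) / t\<close> unchanged.
\<close>

lemma exponential_moment_step:
  fixes \<nu> :: "'a::metric_space measure"
  assumes compact: "compact (UNIV :: 'a set)" and prob: "prob_space \<nu>" and sets: "sets \<nu> = sets borel"
    and K: "0 < K" and LSI: "LSI \<nu> K" and f: "continuous_on UNIV f"
    and B: "\<And>x. \<bar>f x\<bar> \<le> B" and D: "\<And>x y::'a. dist x y \<le> D"
    and t: "0 < t" and s: "0 \<le> s" and R: "B + D\<^sup>2 / (2 * t) \<le> R" "K * s * R \<le> 1"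
  defines "Z \<equiv> \<lambda>t. \<integral>x. exp (K * t * hopf_lax t f x) \<partial>\<nu>"
  shows "ln (Z (t + s)) / (t + s) \<le> ln (Z t) / t + (K * s * R)\<^sup>2 / (t + s)"
proof -
  interpret prob_space \<nu> by fact
  define u where "u = hopf_lax t f"
  define G where "G x = enn2real (subgradient_norm u x)" for x
  define w where "w x = u x - t * (G x)\<^sup>2 / 2" for x
  define e where "e x = exp (K * t * u x)" for x
  have D_nonneg: "0 \<le> D" using D[of undefined undefined] by simp
  have u_lip: "(D / t)-lipschitz_on UNIV u"
    unfolding u_def by (rule hopf_lax_lipschitz[OF compact f t D])
  have u_cont: "continuous_on UNIV u"
    using u_lip by (rule lipschitz_on_continuous_on)
  have u_B: "\<bar>u x\<bar> \<le> B" for x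
    unfolding u_def by (rule hopf_lax_bounded[OF compact f t B])
  have B_nonneg: "0 \<le> B" using B[of undefined] by simp
  have R_nonneg: "0 \<le> R"
    using R(1) B_nonneg t by (smt (verit) divide_nonneg_pos zero_le_power2)
  have G_eq: "subgradient_norm u x = ennreal (G x)" for x
    unfolding G_def by (rule subgradient_norm_eq_ennreal[OF u_lip])
  have G_nonneg: "0 \<le> G x" for x by (simp add: G_def)
  have G_le: "G x \<le> D / t" for x
    unfolding G_def
    using subgradient_norm_lipschitz[OF u_lip, of x] lipschitz_on_nonneg[OF u_lip]
    by (rule enn2real_leI[rotated])
  have [measurable]: "u \<in> borel_measurable borel" "G \<in> borel_measurable borel"
    unfolding G_def using u_cont subgradient_norm_measurable[OF u_cont]
    by (auto intro: borel_measurable_continuous_onI)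
  have G_sq: "t * (G x)\<^sup>2 / 2 \<le> D\<^sup>2 / (2 * t)" for x
  proof -
    have "t * (G x)\<^sup>2 / 2 \<le> t * (D / t)\<^sup>2 / 2"
      using G_le[of x] G_nonneg[of x] t by (intro divide_right_mono mult_left_mono power_mono) auto
    then show ?thesis
      using t by (simp add: power2_eq_square field_simps)
  qed
  have w_R: "\<bar>w x\<bar> \<le> R" for x
    using G_sq[of x] u_B[of x] R(1) t unfolding w_def
    by (smt (verit) divide_nonneg_nonneg mult_nonneg_nonneg zero_le_power2)
  have e_pos: "0 < e x" and e_le: "e x \<le> exp (K * t * B)" for x
    using u_B[of x] K t by (auto simp: e_def)
  have [measurable]: "w \<in> borel_measurable borel" "e \<in> borel_measurable borel"
    unfolding w_def[abs_def] e_def[abs_def] by measurable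
  have int_e: "integrable \<nu> e"
    by (rule integrable_bounded_borel[OF prob sets, where B="exp (K * t * B)"])
       (use e_pos e_le in \<open>auto simp: abs_of_pos\<close>)
  have int_ue: "integrable \<nu> (\<lambda>x. u x * e x)"
    by (rule integrable_bounded_borel[OF prob sets, where B="B * exp (K * t * B)"])
       (use e_pos less_imp_le[OF e_pos] e_le u_B B_nonneg in \<open>auto simp: abs_mult abs_of_pos intro!: mult_mono\<close>)
  have int_Ge: "integrable \<nu> (\<lambda>x. (G x)\<^sup>2 * e x)"
    by (rule integrable_bounded_borel[OF prob sets, where B="(D / t)\<^sup>2 * exp (K * t * B)"])
       (use e_pos less_imp_le[OF e_pos] e_le G_le G_nonneg in \<open>auto simp: abs_mult abs_of_pos intro!: mult_mono power_mono\<close>)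
  have we: "w x * e x = u x * e x - t / 2 * ((G x)\<^sup>2 * e x)" for x
    by (simp add: w_def algebra_simps)
  have int_we: "integrable \<nu> (\<lambda>x. w x * e x)"
    unfolding we using int_ue int_Ge by auto
  have Z_eq: "Z t = (\<integral>x. e x \<partial>\<nu>)"
    by (simp add: Z_def e_def[abs_def] u_def)
  have Z_pos: "0 < Z r" if "0 < r" for r
    unfolding Z_def using hopf_lax_continuous[OF compact f that]
    by (intro integral_exp_pos_compact_space[OF compact prob sets] continuous_intros)
  have LSI_u: "t * (K * (\<integral>x. w x * e x \<partial>\<nu>)) \<le> Z t * ln (Z t)"
  proof -
    define v where "v x = K * t * u x" for x
    have Kt: "0 < K * t" using K t by simp
    have v_lip: "(\<bar>K * t\<bar> * (D / t))-lipschitz_on UNIV v"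
      unfolding v_def[abs_def] using u_lip by (rule lipschitz_on_cmult_real)
    have G_v: "enn2real (subgradient_norm v x) \<le> K * t * G x" for x
    proof -
      have "subgradient_norm v x \<le> ennreal (K * t) * ennreal (G x)"
        unfolding G_eq[symmetric]
        by (rule subgradient_norm_comparison)
           (use Kt in \<open>auto simp: v_def max_def mult_le_cancel_left_pos simp flip: right_diff_distrib\<close>)
      also have "\<dots> = ennreal (K * t * G x)"
        using Kt G_nonneg[of x] by (intro ennreal_mult[symmetric]) auto
      finally show ?thesis
        using Kt G_nonneg[of x] by (intro enn2real_leI) auto
    qed
    have int_v: "integrable \<nu> (\<lambda>x. (enn2real (subgradient_norm v x))\<^sup>2 * exp (v x))"
    proof (rule Bochner_Integration.integrable_bound)
      show "integrable \<nu> (\<lambda>x. (K * t)\<^sup>2 * ((G x)\<^sup>2 * e x))" using int_Ge by auto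
      have "subgradient_norm v \<in> borel_measurable borel" "v \<in> borel_measurable borel"
        using lipschitz_on_continuous_on[OF v_lip]
        by (auto intro: subgradient_norm_measurable borel_measurable_continuous_onI)
      then show "(\<lambda>x. (enn2real (subgradient_norm v x))\<^sup>2 * exp (v x)) \<in> borel_measurable \<nu>"
        unfolding measurable_cong_sets[OF sets refl] by measurable
      have "(enn2real (subgradient_norm v x))\<^sup>2 * exp (v x) \<le> (K * t)\<^sup>2 * ((G x)\<^sup>2 * e x)" for x
        using power_mono[OF G_v[of x], of 2] by (simp add: e_def v_def power_mult_distrib mult.assoc[symmetric])
      then show "AE x in \<nu>. norm ((enn2real (subgradient_norm v x))\<^sup>2 * exp (v x))
          \<le> norm ((K * t)\<^sup>2 * ((G x)\<^sup>2 * e x))"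
        by (simp add: abs_mult e_def)
    qed
    have "K * t * (\<integral>x. u x * e x \<partial>\<nu>) - Z t * ln (Z t)
        = (\<integral>x. v x * exp (v x) \<partial>\<nu>) - (\<integral>x. exp (v x) \<partial>\<nu>) * ln (\<integral>x. exp (v x) \<partial>\<nu>)"
      using integral_mult_right_zero[of \<nu> "K * t" "\<lambda>x. u x * e x"]
      by (simp add: Z_eq v_def e_def[abs_def] mult.assoc)
    also have "\<dots> \<le> 1 / (2 * K) * (\<integral>x. (enn2real (subgradient_norm v x))\<^sup>2 * exp (v x) \<partial>\<nu>)"
      by (rule LSI_exponential[OF compact prob sets K LSI v_lip])
    also have "\<dots> \<le> 1 / (2 * K) * (\<integral>x. (K * t)\<^sup>2 * ((G x)\<^sup>2 * e x) \<partial>\<nu>)"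
    proof (intro mult_left_mono integral_mono int_v)
      show "integrable \<nu> (\<lambda>x. (K * t)\<^sup>2 * ((G x)\<^sup>2 * e x))" using int_Ge by auto
      show "(enn2real (subgradient_norm v x))\<^sup>2 * exp (v x) \<le> (K * t)\<^sup>2 * ((G x)\<^sup>2 * e x)" for x
        using power_mono[OF G_v[of x], of 2] by (simp add: e_def v_def power_mult_distrib mult.assoc[symmetric])
    qed (use K in auto)
    also have "\<dots> = K * t * (t / 2 * (\<integral>x. (G x)\<^sup>2 * e x \<partial>\<nu>))"
      using K by (simp add: power2_eq_square)
    finally have "K * t * ((\<integral>x. u x * e x \<partial>\<nu>) - t / 2 * (\<integral>x. (G x)\<^sup>2 * e x \<partial>\<nu>)) \<le> Z t * ln (Z t)"
      by (simp add: right_diff_distrib)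
    moreover have "(\<integral>x. w x * e x \<partial>\<nu>) = (\<integral>x. u x * e x \<partial>\<nu>) - t / 2 * (\<integral>x. (G x)\<^sup>2 * e x \<partial>\<nu>)"
      unfolding we using int_ue int_Ge by simp
    ultimately show ?thesis by (simp add: mult_ac)
  qed
  have "Z (t + s) \<le> (\<integral>x. e x + K * s * (w x * e x) + (K * s * R)\<^sup>2 * e x \<partial>\<nu>)"
    unfolding Z_def
  proof (rule integral_mono)
    show "integrable \<nu> (\<lambda>x. exp (K * (t + s) * hopf_lax (t + s) f x))"
      using hopf_lax_continuous[OF compact f, of "t + s"] s t
      by (intro integrable_continuous_compact_space[OF compact prob sets] continuous_intros) auto
    show "integrable \<nu> (\<lambda>x. e x + K * s * (w x * e x) + (K * s * R)\<^sup>2 * e x)"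
      using int_e int_we by auto
    fix x
    have "K * (t + s) * hopf_lax (t + s) f x \<le> K * (t + s) * (u x - s * t * (G x)\<^sup>2 / (2 * (t + s)))"
      using hopf_lax_decay[OF compact f t s, of x] K s t
      by (intro mult_left_mono) (auto simp: u_def G_def)
    also have "\<dots> = K * t * u x + K * s * w x"
      using s t by (simp add: w_def field_simps)
    finally have "exp (K * (t + s) * hopf_lax (t + s) f x) \<le> e x * exp (K * s * w x)"
      by (simp add: e_def flip: exp_add)
    also have "\<dots> \<le> e x * (1 + K * s * w x + (K * s * w x)\<^sup>2)"
    proof (intro mult_left_mono exp_le_quadratic)
      have "K * s * w x \<le> K * s * R"
        using w_R[of x] K s by (intro mult_left_mono) auto
      with R(2) show "K * s * w x \<le> 1" by simp
    qed (use e_pos[of x] in auto)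
    also have "\<dots> \<le> e x * (1 + K * s * w x + (K * s * R)\<^sup>2)"
    proof (intro mult_left_mono add_left_mono)
      have "\<bar>K * s * w x\<bar> \<le> \<bar>K * s * R\<bar>"
        using w_R[of x] K s R_nonneg by (auto simp: abs_mult intro!: mult_left_mono)
      then show "(K * s * w x)\<^sup>2 \<le> (K * s * R)\<^sup>2"
        by (simp add: abs_le_square_iff)
    qed (use e_pos[of x] in auto)
    finally show "exp (K * (t + s) * hopf_lax (t + s) f x) \<le> e x + K * s * (w x * e x) + (K * s * R)\<^sup>2 * e x"
      by (simp add: algebra_simps)
  qed
  also have "\<dots> = Z t + s / t * (t * (K * (\<integral>x. w x * e x \<partial>\<nu>))) + (K * s * R)\<^sup>2 * Z t"
    using int_e int_we t by (simp add: Z_eq)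
  also have "\<dots> \<le> Z t + s / t * (Z t * ln (Z t)) + (K * s * R)\<^sup>2 * Z t"
    using LSI_u s t by (intro add_mono mult_left_mono) auto
  also have "\<dots> = Z t * (1 + (s / t * ln (Z t) + (K * s * R)\<^sup>2))"
    by (simp add: algebra_simps)
  also have "\<dots> \<le> Z t * exp (s / t * ln (Z t) + (K * s * R)\<^sup>2)"
    using Z_pos[OF t] by (intro mult_left_mono exp_ge_add_one_self) auto
  finally have "ln (Z (t + s)) \<le> ln (Z t * exp (s / t * ln (Z t) + (K * s * R)\<^sup>2))"
    using Z_pos[of "t + s"] Z_pos[OF t] s t by (subst ln_le_cancel_iff) auto
  also have "\<dots> = (t + s) * (ln (Z t) / t) + (K * s * R)\<^sup>2"
    using Z_pos[OF t] t by (simp add: ln_mult field_simps)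
  finally show ?thesis
    using s t by (simp add: pos_divide_le_eq distrib_left mult.commute)
qed

text \<open>
  The function \<open>ln Z(t) / t\<close> decreases on \<open>(0,1]\<close>, and \<open>Q\<^sub>a f \<le> f\<close> bounds it for small \<open>a\<close> by
  \<open>K \<integral> f d\<nu> + O(a)\<close>.
\<close>

lemma LSI_imp_exponential_moment_bound:
  fixes \<nu> :: "'a::metric_space measure"
  assumes compact: "compact (UNIV :: 'a set)" and prob: "prob_space \<nu>" and sets: "sets \<nu> = sets borel"
    and K: "0 < K" and LSI: "LSI \<nu> K" and f: "continuous_on UNIV f"
  shows "ln (\<integral>x. exp (K * hopf_lax 1 f x) \<partial>\<nu>) \<le> K * (\<integral>x. f x \<partial>\<nu>)"
proof -
  interpret prob_space \<nu> by fact
  obtain B where B: "0 < B" "\<And>x. \<bar>f x\<bar> \<le> B"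
    using compact_space_continuous_bounded[OF compact f] by blast
  obtain D where D: "0 < D" "\<And>x y::'a. dist x y \<le> D"
    using compact_space_dist_bounded[OF compact] by blast
  define Z where "Z t = (\<integral>x. exp (K * t * hopf_lax t f x) \<partial>\<nu>)" for t
  have mono: "ln (Z 1) / 1 \<le> ln (Z a) / a" if a: "0 < a" "a < 1" for a
  proof -
    define R where "R = B + D\<^sup>2 / (2 * a)"
    have R: "0 < R" using B(1) a by (auto simp: R_def intro!: add_pos_nonneg)
    show ?thesis
    proof (rule antimono_if_quadratic_increment[of a 1 "1 / (K * R)" "\<lambda>t. ln (Z t) / t" "(K * R)\<^sup>2 / a"])
      fix t s :: real assume t: "a \<le> t" and s: "0 \<le> s" "s \<le> 1 / (K * R)"
      have "ln (Z (t + s)) / (t + s) \<le> ln (Z t) / t + (K * s * R)\<^sup>2 / (t + s)"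
        unfolding Z_def
      proof (rule exponential_moment_step[OF compact prob sets K LSI f B(2) D(2)])
        have "D\<^sup>2 / (2 * t) \<le> D\<^sup>2 / (2 * a)" using t a by (intro divide_left_mono) auto
        then show "B + D\<^sup>2 / (2 * t) \<le> R" by (simp add: R_def)
        show "K * s * R \<le> 1" using s K R by (simp add: field_simps)
      qed (use t a s in auto)
      also have "(K * s * R)\<^sup>2 / (t + s) \<le> (K * s * R)\<^sup>2 / a"
        using t a s by (intro divide_left_mono) auto
      finally show "ln (Z (t + s)) / (t + s) \<le> ln (Z t) / t + (K * R)\<^sup>2 / a * s\<^sup>2"
        by (simp add: power_mult_distrib mult_ac)
    qed (use a K R in auto)
  qed
  have "ln (Z 1) \<le> K * (\<integral>x. f x \<partial>\<nu>)"
  proof (rule le_if_le_plus_linear[of "min 1 (1 / (K * B))" _ _ "(K * B)\<^sup>2"])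
    fix a :: real assume a: "0 < a" "a < min 1 (1 / (K * B))"
    have int_f: "integrable \<nu> f"
      by (rule integrable_continuous_compact_space[OF compact prob sets f])
    have "Z a \<le> (\<integral>x. 1 + K * a * f x + (K * a * B)\<^sup>2 \<partial>\<nu>)"
      unfolding Z_def
    proof (rule integral_mono)
      show "integrable \<nu> (\<lambda>x. exp (K * a * hopf_lax a f x))"
        using hopf_lax_continuous[OF compact f a(1)]
        by (intro integrable_continuous_compact_space[OF compact prob sets] continuous_intros) auto
      show "integrable \<nu> (\<lambda>x. 1 + K * a * f x + (K * a * B)\<^sup>2)"
        using int_f by auto
      fix x
      have "exp (K * a * hopf_lax a f x) \<le> exp (K * a * f x)"
        using hopf_lax_le_self[OF compact f a(1), of x] K a by simp
      also have "\<dots> \<le> 1 + K * a * f x + (K * a * f x)\<^sup>2"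
      proof (rule exp_le_quadratic)
        have "K * a * f x \<le> K * a * B" using B(2)[of x] K a by (intro mult_left_mono) auto
        also have "\<dots> \<le> 1" using a K B(1) by (simp add: field_simps)
        finally show "K * a * f x \<le> 1" .
      qed
      also have "(K * a * f x)\<^sup>2 \<le> (K * a * B)\<^sup>2"
        unfolding abs_le_square_iff[symmetric]
        using B(1) B(2)[of x] K a by (auto simp: abs_mult intro!: mult_left_mono)
      finally show "exp (K * a * hopf_lax a f x) \<le> 1 + K * a * f x + (K * a * B)\<^sup>2" by simp
    qed
    also have "\<dots> = 1 + (a * (K * (\<integral>x. f x \<partial>\<nu>)) + (K * a * B)\<^sup>2)"
      using int_f by (simp add: prob_space)
    also have "\<dots> \<le> exp (a * (K * (\<integral>x. f x \<partial>\<nu>)) + (K * a * B)\<^sup>2)"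
      by (rule exp_ge_add_one_self)
    finally have Z_le: "Z a \<le> exp (a * (K * (\<integral>x. f x \<partial>\<nu>)) + (K * a * B)\<^sup>2)" .
    have Z_pos: "0 < Z a"
      unfolding Z_def using hopf_lax_continuous[OF compact f a(1)]
      by (intro integral_exp_pos_compact_space[OF compact prob sets] continuous_intros)
    have "ln (Z a) \<le> ln (exp (a * (K * (\<integral>x. f x \<partial>\<nu>)) + (K * a * B)\<^sup>2))"
      using Z_le Z_pos by (subst ln_le_cancel_iff) auto
    then have "ln (Z a) \<le> a * (K * (\<integral>x. f x \<partial>\<nu>)) + (K * a * B)\<^sup>2"
      by simp
    then have "ln (Z a) / a \<le> K * (\<integral>x. f x \<partial>\<nu>) + a * (K * B)\<^sup>2"
      using a by (simp add: divide_le_eq power_mult_distrib power2_eq_square algebra_simps)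
    then show "ln (Z 1) \<le> K * (\<integral>x. f x \<partial>\<nu>) + a * (K * B)\<^sup>2"
      using mono[of a] a by simp
  qed (use K B in auto)
  then show ?thesis by (simp add: Z_def)
qed

section \<open>Prescribing the marginals of a softmax kernel\<close>

lemma compact_box_function_space:
  fixes r :: real
  shows "compact {a :: 'j \<Rightarrow> real. (\<forall>j\<in>S. r \<le> a j \<and> a j \<le> 0) \<and> (\<forall>j. j \<notin> S \<longrightarrow> a j = 0)}"
proof -
  let ?X = "\<lambda>j. if j \<in> S then {r..0} else {0::real}"
  have "compactin (product_topology (\<lambda>j::'j. euclidean) UNIV) (PiE UNIV ?X)"
    unfolding compactin_PiE by (simp add: compactin_euclidean_iff)
  moreover have "PiE UNIV ?X = {a. (\<forall>j\<in>S. r \<le> a j \<and> a j \<le> 0) \<and> (\<forall>j. j \<notin> S \<longrightarrow> a j = 0)}"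
    by (auto simp: PiE_iff split: if_splits)
  ultimately show ?thesis
    by (simp add: euclidean_product_topology compactin_euclidean_iff)
qed

text \<open>
  Minimize the convex function \<open>J(a) = \<integral> ln (\<Sum>\<^sub>k exp(a\<^sub>k - C\<^sub>k)) d\<mu> - \<Sum>\<^sub>k a\<^sub>k p\<^sub>k\<close>, whose partial
  derivatives are the differences of the two sides of the claim. Adding a constant to \<open>a\<close> does not change
  \<open>J\<close>; normalized by \<open>max a = 0\<close>, the function exceeds \<open>J(0)\<close> outside a box because all \<open>p\<^sub>k\<close> are
  positive, so a minimum exists by compactness. Raising a single \<open>a\<^sub>j\<close> from the minimum gives
  \<open>p\<^sub>j \<le> \<integral> s\<^sub>j d\<mu>\<close> for the softmax weight \<open>s\<^sub>j\<close>, and since both sides sum to \<open>1\<close>, equality holds.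
\<close>

lemma softmax_marginals:
  fixes \<mu> :: "'a measure" and C :: "'a \<Rightarrow> 'j \<Rightarrow> real" and p :: "'j \<Rightarrow> real"
  assumes prob: "prob_space \<mu>" and S: "finite S" "S \<noteq> {}"
    and p: "\<And>j. j \<in> S \<Longrightarrow> 0 < p j" "sum p S = 1"
    and C_meas: "\<And>j. j \<in> S \<Longrightarrow> (\<lambda>x. C x j) \<in> borel_measurable \<mu>"
    and C_le: "\<And>x j. j \<in> S \<Longrightarrow> \<bar>C x j\<bar> \<le> M"
  obtains a where "\<And>j. j \<in> S \<Longrightarrow>
    (\<integral>x. exp (a j - C x j) / (\<Sum>k\<in>S. exp (a k - C x k)) \<partial>\<mu>) = p j"
proof -
  interpret prob_space \<mu> by fact
  define N where "N a x = (\<Sum>k\<in>S. exp (a k - C x k))" for a x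
  define J where "J a = (\<integral>x. ln (N a x) \<partial>\<mu>) - (\<Sum>k\<in>S. a k * p k)" for a
  have N_pos: "0 < N a x" for a x
    unfolding N_def using S by (intro sum_pos) auto
  have N_meas [measurable]: "N a \<in> borel_measurable \<mu>" for a
    unfolding N_def[abs_def] using C_meas by measurable
  have M: "0 \<le> M" using C_le S by (metis abs_ge_zero all_not_in_conv order_trans)
  have N_shift: "N b x \<le> exp (\<Sum>k\<in>S. \<bar>b k - a k\<bar>) * N a x" for a b x
    unfolding N_def sum_distrib_left
  proof (rule sum_mono)
    fix k assume k: "k \<in> S"
    have "b k - a k \<le> (\<Sum>k\<in>S. \<bar>b k - a k\<bar>)"
      using member_le_sum[OF k, of "\<lambda>k. \<bar>b k - a k\<bar>"] S by auto
    then show "exp (b k - C x k) \<le> exp (\<Sum>k\<in>S. \<bar>b k - a k\<bar>) * exp (a k - C x k)"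
      by (simp flip: exp_add)
  qed
  have lnN_shift: "ln (N b x) \<le> (\<Sum>k\<in>S. \<bar>b k - a k\<bar>) + ln (N a x)" for a b x
  proof -
    have "ln (N b x) \<le> ln (exp (\<Sum>k\<in>S. \<bar>b k - a k\<bar>) * N a x)"
      using N_shift[of b x a] N_pos by (subst ln_le_cancel_iff) auto
    then show ?thesis using N_pos[of a x] by (simp add: ln_mult)
  qed
  have lnN0: "\<bar>ln (N (\<lambda>_. 0) x)\<bar> \<le> M + ln (card S)" for x
  proof -
    have card: "1 \<le> real (card S)" using S by (simp add: Suc_le_eq card_gt_0_iff)
    have "N (\<lambda>_. 0) x \<le> (\<Sum>k\<in>S. exp M)"
      unfolding N_def using C_le by (intro sum_mono) (auto simp: abs_le_iff)
    then have "ln (N (\<lambda>_. 0) x) \<le> ln (card S * exp M)"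
      using N_pos[of "\<lambda>_. 0" x] card by (subst ln_le_cancel_iff) auto
    also have "\<dots> = M + ln (card S)" using card by (simp add: ln_mult)
    finally have 1: "ln (N (\<lambda>_. 0) x) \<le> M + ln (card S)" .
    obtain k where k: "k \<in> S" using S by auto
    have "exp (- M) \<le> exp (0 - C x k)" using C_le[OF k, of x] by (simp add: abs_le_iff)
    also have "\<dots> \<le> N (\<lambda>_. 0) x"
      unfolding N_def using S k by (intro member_le_sum[of k S "\<lambda>k. exp (0 - C x k)"]) auto
    finally have "ln (exp (- M)) \<le> ln (N (\<lambda>_. 0) x)"
      using N_pos[of "\<lambda>_. 0" x] by (subst ln_le_cancel_iff) auto
    moreover have "0 \<le> ln (real (card S))" using card by simp
    ultimately show ?thesis using 1 by simp
  qed
  have int_lnN: "integrable \<mu> (\<lambda>x. ln (N a x))" for a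
  proof (rule integrable_const_bound)
    have "\<bar>ln (N a x)\<bar> \<le> (\<Sum>k\<in>S. \<bar>a k\<bar>) + (M + ln (card S))" for x
      using lnN_shift[of a x "\<lambda>_. 0"] lnN_shift[of "\<lambda>_. 0" x a] lnN0[of x] by simp
    then show "AE x in \<mu>. norm (ln (N a x)) \<le> (\<Sum>k\<in>S. \<bar>a k\<bar>) + (M + ln (card S))" by simp
  qed measurable
  have J_diff: "\<bar>J b - J a\<bar> \<le> (\<Sum>k\<in>S. \<bar>b k - a k\<bar>) + (\<Sum>k\<in>S. \<bar>b k - a k\<bar> * p k)" for a b
  proof -
    have *: "(\<integral>x. ln (N b x) \<partial>\<mu>) - (\<integral>x. ln (N a x) \<partial>\<mu>) \<le> (\<Sum>k\<in>S. \<bar>b k - a k\<bar>)" for a b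
    proof -
      have "(\<integral>x. ln (N b x) \<partial>\<mu>) \<le> (\<integral>x. (\<Sum>k\<in>S. \<bar>b k - a k\<bar>) + ln (N a x) \<partial>\<mu>)"
        using int_lnN lnN_shift by (intro integral_mono) auto
      then show ?thesis using int_lnN[of a] by (simp add: prob_space)
    qed
    have "\<bar>(\<Sum>k\<in>S. b k * p k) - (\<Sum>k\<in>S. a k * p k)\<bar> \<le> (\<Sum>k\<in>S. \<bar>b k * p k - a k * p k\<bar>)"
      unfolding sum_subtractf[symmetric] by (rule sum_abs)
    also have "\<dots> = (\<Sum>k\<in>S. \<bar>b k - a k\<bar> * p k)"
    proof (rule sum.cong)
      fix k assume "k \<in> S"
      then have "\<bar>p k\<bar> = p k" using p(1) by (simp add: less_imp_le)
      then show "\<bar>b k * p k - a k * p k\<bar> = \<bar>b k - a k\<bar> * p k"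
        by (metis abs_mult left_diff_distrib)
    qed simp
    finally have "\<bar>(\<Sum>k\<in>S. b k * p k) - (\<Sum>k\<in>S. a k * p k)\<bar> \<le> (\<Sum>k\<in>S. \<bar>b k - a k\<bar> * p k)" .
    moreover have "(\<Sum>k\<in>S. \<bar>a k - b k\<bar>) = (\<Sum>k\<in>S. \<bar>b k - a k\<bar>)"
      by (simp add: abs_minus_commute)
    ultimately show ?thesis
      using *[of b a] *[of a b] unfolding J_def by linarith
  qed
  have J_cont: "continuous_on A J" for A
    unfolding continuous_on_def
  proof
    fix a assume "a \<in> A"
    have "continuous_on UNIV (\<lambda>b. (\<Sum>k\<in>S. \<bar>b k - a k\<bar>) + (\<Sum>k\<in>S. \<bar>b k - a k\<bar> * p k))"
      by (intro continuous_intros continuous_on_product_coordinates)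
    then have "((\<lambda>b. (\<Sum>k\<in>S. \<bar>b k - a k\<bar>) + (\<Sum>k\<in>S. \<bar>b k - a k\<bar> * p k))
        \<longlongrightarrow> (\<Sum>k\<in>S. \<bar>a k - a k\<bar>) + (\<Sum>k\<in>S. \<bar>a k - a k\<bar> * p k)) (at a)"
      unfolding continuous_on_def by blast
    then have "((\<lambda>b. (\<Sum>k\<in>S. \<bar>b k - a k\<bar>) + (\<Sum>k\<in>S. \<bar>b k - a k\<bar> * p k)) \<longlongrightarrow> 0) (at a)"
      by simp
    then have "((\<lambda>b. (\<Sum>k\<in>S. \<bar>b k - a k\<bar>) + (\<Sum>k\<in>S. \<bar>b k - a k\<bar> * p k)) \<longlongrightarrow> 0) (at a within A)"
      by (rule tendsto_within_subset) simp
    then have "((\<lambda>b. J b - J a) \<longlongrightarrow> 0) (at a within A)"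
      by (rule Lim_null_comparison[rotated]) (simp add: J_diff)
    then show "(J \<longlongrightarrow> J a) (at a within A)"
      by (rule LIM_zero_cancel)
  qed
  define pmin where "pmin = Min (p ` S)"
  have pmin: "0 < pmin" "\<And>k. k \<in> S \<Longrightarrow> pmin \<le> p k"
    unfolding pmin_def using S p by auto
  \<comment> \<open>A vector with maximum \<open>0\<close> and an entry below \<open>- R\<close> has \<open>J \<ge> - M + R pmin = M + ln (card S) \<ge> J(0)\<close>.\<close>
  define R where "R = (2 * M + ln (card S)) / pmin"
  have card: "1 \<le> real (card S)" using S by (simp add: Suc_le_eq card_gt_0_iff)
  have R: "0 \<le> R" unfolding R_def using pmin M card by (intro divide_nonneg_pos) auto
  define Box where "Box = {a :: 'j \<Rightarrow> real. (\<forall>j\<in>S. - R \<le> a j \<and> a j \<le> 0) \<and> (\<forall>j. j \<notin> S \<longrightarrow> a j = 0)}"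
  have zero_Box: "(\<lambda>_. 0) \<in> Box" using R by (simp add: Box_def)
  obtain a where a: "a \<in> Box" "\<And>b. b \<in> Box \<Longrightarrow> J a \<le> J b"
    using continuous_attains_inf[of Box J] compact_box_function_space[of S "- R"] zero_Box J_cont
    unfolding Box_def[symmetric] by blast
  have J_min: "J a \<le> J b" for b
  proof -
    define m where "m = Max (b ` S)"
    define b' where "b' k = (if k \<in> S then b k - m else 0)" for k
    have b'_le: "b' k \<le> 0" for k using S by (auto simp: b'_def m_def)
    have "m \<in> b ` S"
      unfolding m_def using S by (intro Max_in) auto
    then obtain k0 where k0: "k0 \<in> S" "b' k0 = 0"
      by (auto simp: b'_def)
    have "N b' x = exp (- m) * N b x" for x
      unfolding N_def sum_distrib_left by (intro sum.cong) (auto simp: b'_def simp flip: exp_add)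
    then have "ln (N b' x) = ln (N b x) - m" for x
      using N_pos[of b x] by (simp add: ln_mult)
    moreover have "(\<Sum>k\<in>S. b' k * p k) = (\<Sum>k\<in>S. b k * p k) - m"
      using p(2) by (simp add: b'_def left_diff_distrib sum_subtractf flip: sum_distrib_left)
    ultimately have J_eq: "J b' = J b"
      unfolding J_def using int_lnN[of b] by (simp add: prob_space)
    show ?thesis
    proof (cases "b' \<in> Box")
      case True
      then show ?thesis using a(2)[of b'] J_eq by simp
    next
      case False
      moreover have "\<forall>j. j \<notin> S \<longrightarrow> b' j = 0"
        by (simp add: b'_def)
      ultimately obtain k where "k \<in> S" "\<not> (- R \<le> b' k \<and> b' k \<le> 0)"
        unfolding Box_def by blast
      then have k: "k \<in> S" "b' k < - R"
        using b'_le[of k] by auto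
      have "- M \<le> ln (N b' x)" for x
      proof -
        have "exp (- M) \<le> exp (b' k0 - C x k0)" using C_le[OF k0(1), of x] k0(2) by (simp add: abs_le_iff)
        also have "\<dots> \<le> N b' x"
          unfolding N_def using S k0 by (intro member_le_sum[of k0 S "\<lambda>k. exp (b' k - C x k)"]) auto
        finally have "ln (exp (- M)) \<le> ln (N b' x)"
          using N_pos[of b' x] by (subst ln_le_cancel_iff) auto
        then show ?thesis by simp
      qed
      then have "(\<integral>x. - M \<partial>\<mu>) \<le> (\<integral>x. ln (N b' x) \<partial>\<mu>)"
        using int_lnN by (intro integral_mono) auto
      then have 1: "- M \<le> (\<integral>x. ln (N b' x) \<partial>\<mu>)" by (simp add: prob_space)
      have "- (b' k * p k) \<le> (\<Sum>i\<in>S. - (b' i * p i))"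
        using S k(1) p(1) b'_le
        by (intro member_le_sum) (auto intro: mult_nonpos_nonneg less_imp_le)
      then have "(\<Sum>i\<in>S. b' i * p i) \<le> b' k * p k"
        by (simp add: sum_negf)
      also have "\<dots> \<le> b' k * pmin"
        using pmin(2)[OF k(1)] b'_le[of k] by (simp add: mult_left_mono_neg)
      also have "\<dots> \<le> - R * pmin"
        using k pmin by (intro mult_right_mono) auto
      also have "\<dots> = - (2 * M + ln (card S))"
        using pmin by (simp add: R_def)
      finally have 2: "M + ln (card S) \<le> J b'"
        using 1 by (simp add: J_def)
      have "(\<integral>x. ln (N (\<lambda>_. 0) x) \<partial>\<mu>) \<le> (\<integral>x. M + ln (card S) \<partial>\<mu>)"
        using int_lnN lnN0 by (intro integral_mono) (auto simp: abs_le_iff)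
      then have "J (\<lambda>_. 0) \<le> M + ln (card S)"
        by (simp add: J_def prob_space)
      with 2 a(2)[OF zero_Box] J_eq show ?thesis by simp
    qed
  qed
  define s where "s j x = exp (a j - C x j) / N a x" for j x
  have s_pos: "0 < s j x" for j x using N_pos by (simp add: s_def)
  have s_sum: "(\<Sum>j\<in>S. s j x) = 1" for x
    using N_pos[of a x] by (simp add: s_def N_def flip: sum_divide_distrib)
  have s_le: "s j x \<le> 1" if "j \<in> S" for j x
    using member_le_sum[of j S "\<lambda>j. s j x"] S that s_pos s_sum[of x] by (simp add: less_imp_le)
  have s_meas: "s j \<in> borel_measurable \<mu>" if "j \<in> S" for j
    unfolding s_def[abs_def] using C_meas[OF that] by measurable
  have int_s: "integrable \<mu> (s j)" if "j \<in> S" for j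
    using s_le[OF that] s_pos[of j] s_meas[OF that]
    by (intro integrable_const_bound[where B=1]) (auto simp: abs_of_pos)
  have p_le: "p j \<le> (\<integral>x. s j x \<partial>\<mu>)" if j: "j \<in> S" for j
  proof (rule le_if_le_plus_linear[of 1 _ _ "p j"])
    fix w :: real assume w: "0 < w" "w < 1"
    define b where "b = a(j := a j + ln (1 + w))"
    \<comment> \<open>With the step \<open>ln (1 + w)\<close> the normalizing sum changes by an affine function of \<open>w\<close>.\<close>
    have "N b x = N a x * (1 + w * s j x)" for x
    proof -
      have "N b x = (\<Sum>k\<in>S. exp (a k - C x k) + (if k = j then w * exp (a j - C x j) else 0))"
        unfolding N_def using w by (intro sum.cong) (auto simp: b_def exp_add exp_diff field_simps)
      also have "\<dots> = N a x + w * exp (a j - C x j)"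
        using S j by (simp add: sum.distrib N_def)
      finally show ?thesis
        using N_pos[of a x] by (simp add: s_def field_simps)
    qed
    note N_b = this
    have lnN: "ln (N b x) = ln (N a x) + ln (1 + w * s j x)" for x
    proof -
      have "0 < 1 + w * s j x" using w s_pos[of j x] by (intro add_pos_pos) auto
      then show ?thesis
        using N_pos[of a x] N_b[of x] by (simp add: ln_mult)
    qed
    have "(\<integral>x. ln (N b x) \<partial>\<mu>) \<le> (\<integral>x. ln (N a x) + w * s j x \<partial>\<mu>)"
    proof (rule integral_mono)
      show "integrable \<mu> (\<lambda>x. ln (N b x))" by (rule int_lnN)
      show "integrable \<mu> (\<lambda>x. ln (N a x) + w * s j x)" using int_lnN int_s[OF j] by auto
      show "ln (N b x) \<le> ln (N a x) + w * s j x" for x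
        using ln_add_one_self_le_self[of "w * s j x"] w s_pos[of j x] unfolding lnN by simp
    qed
    also have "\<dots> = (\<integral>x. ln (N a x) \<partial>\<mu>) + w * (\<integral>x. s j x \<partial>\<mu>)"
      using int_lnN int_s[OF j] by simp
    finally have 1: "(\<integral>x. ln (N b x) \<partial>\<mu>) \<le> (\<integral>x. ln (N a x) \<partial>\<mu>) + w * (\<integral>x. s j x \<partial>\<mu>)" .
    have "(\<Sum>k\<in>S. b k * p k) = (\<Sum>k\<in>S. a k * p k + (if k = j then ln (1 + w) * p j else 0))"
      by (intro sum.cong) (auto simp: b_def algebra_simps)
    also have "\<dots> = (\<Sum>k\<in>S. a k * p k) + ln (1 + w) * p j"
      using S j by (simp add: sum.distrib)
    finally have "ln (1 + w) * p j \<le> w * (\<integral>x. s j x \<partial>\<mu>)"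
      using 1 J_min[of b] by (simp add: J_def)
    moreover have "(w - w\<^sup>2) * p j \<le> ln (1 + w) * p j"
      using w p(1)[OF j] by (intro mult_right_mono ln_one_plus_pos_lower_bound) auto
    ultimately have "w * ((1 - w) * p j) \<le> w * (\<integral>x. s j x \<partial>\<mu>)"
      by (simp add: power2_eq_square algebra_simps)
    then have "(1 - w) * p j \<le> (\<integral>x. s j x \<partial>\<mu>)"
      using w by (simp only: mult_le_cancel_left_pos)
    then show "p j \<le> (\<integral>x. s j x \<partial>\<mu>) + w * p j"
      by (simp add: left_diff_distrib)
  qed simp
  have "(\<Sum>j\<in>S. \<integral>x. s j x \<partial>\<mu>) = (\<integral>x. (\<Sum>j\<in>S. s j x) \<partial>\<mu>)"
    using int_s by simp
  then have sum_eq: "sum p S = (\<Sum>j\<in>S. \<integral>x. s j x \<partial>\<mu>)"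
    by (simp add: s_sum p prob_space)
  have "p j = (\<integral>x. s j x \<partial>\<mu>)" if "j \<in> S" for j
    using sum_mono_inv[OF sum_eq p_le that] S by simp
  then show thesis
    using that[of a] by (simp add: s_def N_def)
qed

section \<open>Kantorovich duality up to a small error\<close>

lemma compact_space_finite_net:
  assumes "compact (UNIV :: 'a::metric_space set)" "0 < \<delta>"
  obtains k :: "'a::metric_space set" where "finite k" "(\<Union>c\<in>k. ball c \<delta>) = UNIV"
  using assms unfolding compact_eq_totally_bounded by blast

text \<open>
  Compactness supplies the countable base: products of balls around the points of finite nets of
  mesh \<open>1/n\<close>.
\<close>

lemma sets_borel_prod_compact_space:
  assumes compact: "compact (UNIV :: 'a::metric_space set)"
  shows "sets (borel \<Otimes>\<^sub>M borel) = sets (borel :: ('a \<times> 'a) measure)"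
proof
  have [measurable]: "fst \<in> (borel :: ('a \<times> 'a) measure) \<rightarrow>\<^sub>M borel" "snd \<in> (borel :: ('a \<times> 'a) measure) \<rightarrow>\<^sub>M borel"
    by (auto intro!: borel_measurable_continuous_onI continuous_intros)
  have id: "(\<lambda>z. (fst z, snd z)) \<in> (borel :: ('a \<times> 'a) measure) \<rightarrow>\<^sub>M borel \<Otimes>\<^sub>M borel"
    by measurable
  show "sets (borel \<Otimes>\<^sub>M borel) \<subseteq> sets (borel :: ('a \<times> 'a) measure)"
  proof
    fix A :: "('a \<times> 'a) set" assume "A \<in> sets (borel \<Otimes>\<^sub>M borel)"
    from measurable_sets[OF id this] show "A \<in> sets borel" by simp
  qed
  obtain k :: "nat \<Rightarrow> 'a set" where k: "\<And>n. finite (k n)" "\<And>n. (\<Union>c\<in>k n. ball c (1 / Suc n)) = UNIV"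
  proof -
    have "\<exists>k::'a set. finite k \<and> (\<Union>c\<in>k. ball c (1 / Suc n)) = UNIV" for n
    proof -
      have "0 < 1 / real (Suc n)" by simp
      then obtain k :: "'a set" where "finite k" "(\<Union>c\<in>k. ball c (1 / real (Suc n))) = UNIV"
        by (rule compact_space_finite_net[OF compact])
      then show ?thesis by (intro exI[of _ k] conjI)
    qed
    then have "\<forall>n. \<exists>k::'a set. finite k \<and> (\<Union>c\<in>k. ball c (1 / Suc n)) = UNIV" ..
    from choice[OF this] show thesis using that by blast
  qed
  have "U \<in> sets (borel \<Otimes>\<^sub>M borel)" if U: "open U" for U :: "('a \<times> 'a) set"
  proof -
    define box where "box = (\<lambda>(n, c, c'). ball (c::'a) (1 / Suc n) \<times> ball (c'::'a) (1 / Suc n))"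
    define I where "I = {i \<in> (SIGMA n:UNIV. k n \<times> k n). box i \<subseteq> U}"
    have "countable I"
      unfolding I_def by (rule countable_subset[of _ "SIGMA n:UNIV. k n \<times> k n"])
        (auto intro!: countable_SIGMA intro: countableI_type countable_finite k(1) simp del: countable_SIGMA)
    moreover have "box i \<in> sets (borel \<Otimes>\<^sub>M borel)" for i
      by (auto simp: box_def split: prod.splits)
    ultimately have "(\<Union>i\<in>I. box i) \<in> sets (borel \<Otimes>\<^sub>M borel)"
      by (intro sets.countable_UN') auto
    moreover have "(\<Union>i\<in>I. box i) = U"
    proof
      show "U \<subseteq> (\<Union>i\<in>I. box i)"
      proof
        fix z assume "z \<in> U"
        obtain x y where z: "z = (x, y)" by (cases z)
        obtain A B where AB: "open A" "open B" "z \<in> A \<times> B" "A \<times> B \<subseteq> U"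
          using open_prod_elim[OF U \<open>z \<in> U\<close>] by blast
        obtain e1 e2 where e: "0 < e1" "ball x e1 \<subseteq> A" "0 < e2" "ball y e2 \<subseteq> B"
          using openE[OF AB(1), of x] openE[OF AB(2), of y] AB(3) unfolding z by (metis SigmaD1 SigmaD2)
        define e where "e = min e1 e2"
        have "0 < e / 2" using e by (simp add: e_def)
        then obtain n where n: "1 / real (Suc n) < e / 2"
          using nat_approx_posE by blast
        obtain c c' where c: "c \<in> k n" "x \<in> ball c (1 / Suc n)" "c' \<in> k n" "y \<in> ball c' (1 / Suc n)"
          using k(2)[of n] by blast
        have "ball c (1 / Suc n) \<subseteq> ball x e1"
        proof
          fix w assume "w \<in> ball c (1 / Suc n)"
          then show "w \<in> ball x e1"
            using c(2) n dist_triangle[of x w c] by (auto simp: e_def dist_commute)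
        qed
        moreover have "ball c' (1 / Suc n) \<subseteq> ball y e2"
        proof
          fix w assume "w \<in> ball c' (1 / Suc n)"
          then show "w \<in> ball y e2"
            using c(4) n dist_triangle[of y w c'] by (auto simp: e_def dist_commute)
        qed
        ultimately have "ball c (1 / Suc n) \<subseteq> A" "ball c' (1 / Suc n) \<subseteq> B"
          using e(2,4) by (blast intro: order_trans)+
        then have "box (n, c, c') \<subseteq> U"
          using AB(4) unfolding box_def split by blast
        then have "(n, c, c') \<in> I" using c by (simp add: I_def)
        moreover have "z \<in> box (n, c, c')" using c z by (simp add: box_def)
        ultimately show "z \<in> (\<Union>i\<in>I. box i)" by blast
      qed
    qed (auto simp: I_def)
    ultimately show ?thesis by simp
  qed
  then have "sigma_sets (space (borel \<Otimes>\<^sub>M borel)) {U :: ('a \<times> 'a) set. open U} \<subseteq> sets (borel \<Otimes>\<^sub>M borel)"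
    by (intro sets.sigma_sets_subset) auto
  then show "sets (borel :: ('a \<times> 'a) measure) \<subseteq> sets (borel \<Otimes>\<^sub>M borel)"
    by (simp add: borel_def space_pair_measure)
qed

text \<open>
  The fibres of \<open>q\<close> are the cells of a finite Borel partition into sets of small diameter.
\<close>

lemma compact_space_finite_quantizer:
  assumes compact: "compact (UNIV :: 'a::metric_space set)" and \<delta>: "0 < \<delta>"
  obtains q :: "'a::metric_space \<Rightarrow> 'a" where "finite (range q)" "\<And>c. q -` {c} \<in> sets borel" "\<And>y. dist (q y) y < \<delta>"
proof -
  obtain k :: "'a set" where k: "finite k" "(\<Union>c\<in>k. ball c \<delta>) = UNIV"
    using compact_space_finite_net[OF assms] by blast
  have "\<exists>q. range q \<subseteq> insert undefined k \<and> (\<forall>c. q -` {c} \<in> sets borel)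
      \<and> (\<forall>y\<in>(\<Union>c\<in>k. ball c \<delta>). dist (q y) y < \<delta>)"
    using k(1)
  proof induction
    case empty
    show ?case by (rule exI[of _ "\<lambda>_. undefined"]) (auto simp: vimage_def)
  next
    case (insert d k)
    then obtain q where q: "range q \<subseteq> insert undefined k" "\<And>c. q -` {c} \<in> sets borel"
        "\<And>y. y \<in> (\<Union>c\<in>k. ball c \<delta>) \<Longrightarrow> dist (q y) y < \<delta>"
      by blast
    define q' where "q' y = (if y \<in> ball d \<delta> then d else q y)" for y
    have "q' -` {c} = (if c = d then ball d \<delta> else {}) \<union> (q -` {c} - ball d \<delta>)" for c
    proof (rule set_eqI)
      fix y
      show "y \<in> q' -` {c} \<longleftrightarrow> y \<in> (if c = d then ball d \<delta> else {}) \<union> (q -` {c} - ball d \<delta>)"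
        by (cases "y \<in> ball d \<delta>"; cases "c = d") (simp_all add: q'_def del: mem_ball)
    qed
    then have "q' -` {c} \<in> sets borel" for c
      using q(2) by auto
    moreover have "range q' \<subseteq> insert undefined (insert d k)"
      using q(1) by (auto simp: q'_def)
    moreover have "dist (q' y) y < \<delta>" if "y \<in> (\<Union>c\<in>insert d k. ball c \<delta>)" for y
      using that q(3)[of y] by (auto simp: q'_def)
    ultimately show ?case by blast
  qed
  then obtain q where q: "range q \<subseteq> insert undefined k" "\<And>c. q -` {c} \<in> sets borel" "\<And>y. dist (q y) y < \<delta>"
    unfolding k(2) by blast
  moreover have "finite (range q)" using q(1) k(1) finite_subset by blast
  ultimately show thesis using that by blast
qed

lemma nn_integral_pair_mult:
  assumes "sigma_finite_measure N" "u \<in> borel_measurable M" "v \<in> borel_measurable N"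
  shows "(\<integral>\<^sup>+z. u (fst z) * v (snd z) \<partial>(M \<Otimes>\<^sub>M N)) = (\<integral>\<^sup>+x. u x \<partial>M) * (\<integral>\<^sup>+y. v y \<partial>N)"
proof -
  interpret sigma_finite_measure N by fact
  have [measurable]: "u \<in> borel_measurable M" "v \<in> borel_measurable N" by fact+
  have "(\<integral>\<^sup>+z. u (fst z) * v (snd z) \<partial>(M \<Otimes>\<^sub>M N)) = (\<integral>\<^sup>+x. \<integral>\<^sup>+y. u x * v y \<partial>N \<partial>M)"
    by (subst nn_integral_fst[symmetric]) auto
  also have "\<dots> = (\<integral>\<^sup>+x. u x \<partial>M) * (\<integral>\<^sup>+y. v y \<partial>N)"
    by (simp add: nn_integral_cmult nn_integral_multc)
  finally show ?thesis .
qed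

lemma neg_mult_ln_le_one:
  fixes x :: real
  assumes "0 < x"
  shows "- (x * ln x) \<le> 1"
proof -
  have "ln (1 / x) \<le> 1 / x - 1"
    using assms by (intro ln_le_minus_one) auto
  then have "x * (- ln x) \<le> x * (1 / x - 1)"
    using assms by (intro mult_left_mono) (auto simp: ln_div)
  also have "\<dots> \<le> 1" using assms by (simp add: right_diff_distrib)
  finally show ?thesis by simp
qed

text \<open>
  Here \<open>q\<close> splits the space into cells \<open>A j\<close> of mass \<open>p j\<close>, and \<open>s j x\<close> are the softmax weights for the
  cost \<open>d(x,j)\<^sup>2/2\<close> at temperature \<open>\<epsilon>\<close>, with parameters \<open>a\<close> for which \<open>\<integral> s j d\<mu> = p j\<close>. The density
  \<open>\<Sum>\<^sub>j s j x / p j\<close> on \<open>A j\<close> relative to \<open>\<mu> \<otimes> \<nu>\<close> then has marginals \<open>\<mu>\<close> and \<open>\<nu>\<close>. With the soft minimum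
  \<open>\<phi> = - \<epsilon> ln (\<Sum>\<^sub>k exp(a k - d(x,k)\<^sup>2/2\<epsilon>))\<close> one has \<open>d(x,j)\<^sup>2/2 = \<phi>(x) + \<epsilon> a j - \<epsilon> ln (s j x)\<close>, so
  \<open>- \<epsilon> a j\<close> and \<open>\<phi>\<close> are admissible potentials whose dual value is the transport cost up to the
  entropy term \<open>- \<epsilon> \<Sum>\<^sub>j s j ln (s j)\<close>. Replacing them by \<open>f = - Q\<^sub>1 (- \<phi>)\<close> and \<open>Q\<^sub>1 f\<close> improves
  both potentials and makes them Lipschitz with a constant that does not depend on the partition, so the cells
  cost only \<open>O(\<delta>)\<close>.
\<close>

lemma kantorovich_duality_approx:
  fixes \<mu> \<nu> :: "'a::metric_space measure"
  assumes compact: "compact (UNIV :: 'a set)"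
    and \<mu>: "prob_space \<mu>" "sets \<mu> = sets borel" and \<nu>: "prob_space \<nu>" "sets \<nu> = sets borel"
    and \<eta>: "0 < \<eta>"
  obtains f \<pi> where "continuous_on UNIV f" "\<pi> \<in> couplings \<mu> \<nu>"
    "(\<integral>\<^sup>+z. ennreal ((dist (fst z) (snd z))\<^sup>2) \<partial>\<pi>)
      \<le> ennreal (2 * ((\<integral>x. hopf_lax 1 f x \<partial>\<mu>) - (\<integral>x. f x \<partial>\<nu>)) + \<eta>)"
proof -
  interpret \<mu>: prob_space \<mu> by fact
  interpret \<nu>: prob_space \<nu> by fact
  have space: "space \<mu> = UNIV" "space \<nu> = UNIV"
    using \<mu>(2) \<nu>(2) by (metis sets_eq_imp_space_eq space_borel)+
  have meas_\<mu>: "measurable \<mu> M = measurable borel M" and meas_\<nu>: "measurable \<nu> M = measurable borel M" for M :: "'c measure"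
    using \<mu>(2) \<nu>(2) by (auto intro: measurable_cong_sets)
  obtain D where D: "0 < D" "\<And>x y::'a. dist x y \<le> D"
    using compact_space_dist_bounded[OF compact] by blast
  \<comment> \<open>The cells cost \<open>D \<delta>\<close> in the dual value and \<open>2 D \<delta>\<close> in the squared distance, the entropy term
    at most \<open>\<epsilon> n\<close>; the choices of \<open>\<delta>\<close> and \<open>\<epsilon>\<close> make the total at most \<open>\<eta>\<close>.\<close>
  define \<delta> where "\<delta> = \<eta> / (8 * D)"
  have \<delta>: "0 < \<delta>" using \<eta> D(1) by (simp add: \<delta>_def)
  obtain q :: "'a \<Rightarrow> 'a" where q: "finite (range q)" "\<And>c. q -` {c} \<in> sets borel" "\<And>y. dist (q y) y < \<delta>"
    using compact_space_finite_quantizer[OF compact \<delta>] by blast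
  define A where "A j = q -` {j}" for j
  have A_sets: "A j \<in> sets \<nu>" and A_borel [measurable]: "A j \<in> sets borel" for j
    using q(2) \<nu>(2) by (auto simp: A_def)
  define p where "p j = measure \<nu> (A j)" for j
  define S where "S = {j \<in> range q. 0 < p j}"
  have S_fin: "finite S" using q(1) by (simp add: S_def)
  have p_pos: "0 < p j" if "j \<in> S" for j using that by (simp add: S_def)
  have p_emeasure: "emeasure \<nu> (A j) = ennreal (p j)" for j
    by (simp add: p_def \<nu>.emeasure_eq_measure)
  have "1 = measure \<nu> (\<Union>j\<in>range q. A j)"
  proof -
    have "(\<Union>j\<in>range q. A j) = UNIV" by (auto simp: A_def)
    then show ?thesis using \<nu>.prob_space space by simp
  qed
  also have "\<dots> = (\<Sum>j\<in>range q. p j)"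
    unfolding p_def using q(1) A_sets
    by (intro \<nu>.finite_measure_finite_Union) (auto simp: A_def disjoint_family_on_def)
  also have "\<dots> = sum p S"
    unfolding S_def using q(1) by (intro sum.mono_neutral_right) (auto simp: p_def zero_less_measure_iff)
  finally have p_sum: "sum p S = 1" by simp
  then have S_ne: "S \<noteq> {}" by auto
  have AE_S: "AE y in \<nu>. q y \<in> S"
  proof -
    have "AE y in \<nu>. y \<notin> A j" if "j \<in> range q - S" for j
    proof (rule AE_not_in)
      have "p j = 0" using that by (auto simp: S_def p_def zero_less_measure_iff)
      then show "A j \<in> null_sets \<nu>"
        using A_sets p_emeasure[of j] by (intro null_setsI) auto
    qed
    then have "AE y in \<nu>. \<forall>j\<in>range q - S. y \<notin> A j"
      using q(1) by (intro AE_finite_allI) auto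
    then show ?thesis by eventually_elim (auto simp: A_def)
  qed
  define n where "n = real (card S)"
  have n: "1 \<le> n" using S_fin S_ne by (simp add: n_def Suc_le_eq card_gt_0_iff)
  define \<epsilon> where "\<epsilon> = \<eta> / (4 * n)"
  have \<epsilon>: "0 < \<epsilon>" using \<eta> n by (simp add: \<epsilon>_def)
  define C where "C x j = (dist x j)\<^sup>2 / (2 * \<epsilon>)" for x j :: 'a
  have C_cont: "continuous_on UNIV (\<lambda>x. C x j)" for j
    unfolding C_def using \<epsilon> by (auto intro!: continuous_intros)
  have C_le: "\<bar>C x j\<bar> \<le> D\<^sup>2 / (2 * \<epsilon>)" for x j
    unfolding C_def using \<epsilon> D(2)[of x j] by (auto intro!: divide_right_mono power_mono)
  obtain a where a: "\<And>j. j \<in> S \<Longrightarrow>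
      (\<integral>x. exp (a j - C x j) / (\<Sum>k\<in>S. exp (a k - C x k)) \<partial>\<mu>) = p j"
    using softmax_marginals[OF \<mu>(1) S_fin S_ne p_pos p_sum, of "\<lambda>x j. C x j" "D\<^sup>2 / (2 * \<epsilon>)"] C_le
      borel_measurable_continuous_onI[OF C_cont] unfolding meas_\<mu> by blast
  define N where "N x = (\<Sum>k\<in>S. exp (a k - C x k))" for x
  define s where "s j x = exp (a j - C x j) / N x" for j x
  define \<phi> where "\<phi> x = - \<epsilon> * ln (N x)" for x
  have N_pos: "0 < N x" for x
    unfolding N_def using S_fin S_ne by (intro sum_pos) auto
  have N_cont: "continuous_on UNIV N"
    unfolding N_def[abs_def] by (auto intro!: continuous_intros C_cont)
  have \<phi>_cont: "continuous_on UNIV \<phi>"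
    unfolding \<phi>_def[abs_def] using N_cont N_pos by (auto intro!: continuous_intros simp: less_imp_neq[symmetric])
  have s_cont: "continuous_on UNIV (s j)" for j
    unfolding s_def[abs_def] using N_cont N_pos by (auto intro!: continuous_intros C_cont simp: less_imp_neq[symmetric])
  then have s_meas [measurable]: "s j \<in> borel_measurable borel" for j
    by (rule borel_measurable_continuous_onI)
  have s_pos: "0 < s j x" for j x using N_pos by (simp add: s_def)
  have s_sum: "(\<Sum>j\<in>S. s j x) = 1" for x
    using N_pos[of x] by (simp add: s_def N_def flip: sum_divide_distrib)
  have s_le: "s j x \<le> 1" if "j \<in> S" for j x
    using member_le_sum[of j S "\<lambda>j. s j x"] S_fin that s_pos s_sum[of x] by (simp add: less_imp_le)
  have int_s: "(\<integral>x. s j x \<partial>\<mu>) = p j" if "j \<in> S" for j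
    using a[OF that] by (simp add: s_def N_def)
  have s_integrable: "integrable \<mu> (s j)" for j
    by (rule integrable_continuous_compact_space[OF compact \<mu> s_cont])
  have cost_eq: "(dist x j)\<^sup>2 / 2 = \<phi> x + \<epsilon> * a j - \<epsilon> * ln (s j x)" for x j
  proof -
    have "ln (s j x) = a j - C x j - ln (N x)"
      using N_pos[of x] by (simp add: s_def ln_div)
    moreover have "\<epsilon> * C x j = (dist x j)\<^sup>2 / 2"
      using \<epsilon> by (simp add: C_def)
    ultimately show ?thesis by (simp add: \<phi>_def right_diff_distrib)
  qed
  define f where "f y = - hopf_lax 1 (\<lambda>x. - \<phi> x) y" for y
  have \<phi>'_cont: "continuous_on UNIV (\<lambda>x. - \<phi> x)" using \<phi>_cont by (intro continuous_intros)
  have f_lip: "D-lipschitz_on UNIV f"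
    using hopf_lax_lipschitz[OF compact \<phi>'_cont, of 1 D] D(2) unfolding f_def by auto
  have f_cont: "continuous_on UNIV f" using f_lip by (rule lipschitz_on_continuous_on)
  have \<phi>_le: "\<phi> x \<le> hopf_lax 1 f x" for x
  proof -
    obtain y where y: "hopf_lax 1 f x = f y + (dist x y)\<^sup>2 / (2 * 1)"
      using hopf_lax_attained[OF compact f_cont, of 1] by auto
    show ?thesis
      using hopf_lax_le[OF compact \<phi>'_cont, of 1 y x] unfolding y by (simp add: f_def dist_commute)
  qed
  have f_le: "f j \<le> - \<epsilon> * a j" if j: "j \<in> S" for j
  proof -
    obtain x where x: "hopf_lax 1 (\<lambda>x. - \<phi> x) j = - \<phi> x + (dist j x)\<^sup>2 / (2 * 1)"
      using hopf_lax_attained[OF compact \<phi>'_cont, of 1] by auto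
    have "ln (s j x) \<le> 0" using s_le[OF j] s_pos[of j x] by (simp add: ln_le_zero_iff)
    then have "\<epsilon> * ln (s j x) \<le> 0" using \<epsilon> by (simp add: mult_nonneg_nonpos)
    moreover have "hopf_lax 1 (\<lambda>x. - \<phi> x) j = - \<phi> x + (\<phi> x + \<epsilon> * a j - \<epsilon> * ln (s j x))"
      using x unfolding cost_eq[symmetric] by (simp add: dist_commute)
    ultimately show ?thesis by (simp add: f_def)
  qed
  have f_int: "integrable \<nu> f"
    by (rule integrable_continuous_compact_space[OF compact \<nu> f_cont])
  have "(\<integral>y. f y \<partial>\<nu>) \<le> (\<integral>y. (\<Sum>j\<in>S. indicator (A j) y * (- \<epsilon> * a j)) + D * \<delta> \<partial>\<nu>)"
  proof (rule integral_mono_AE)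
    show "AE y in \<nu>. f y \<le> (\<Sum>j\<in>S. indicator (A j) y * (- \<epsilon> * a j)) + D * \<delta>"
      using AE_S
    proof eventually_elim
      case (elim y)
      have "(\<Sum>j\<in>S. indicator (A j) y * (- \<epsilon> * a j)) = (\<Sum>j\<in>S. if j = q y then - \<epsilon> * a j else 0)"
        by (intro sum.cong) (auto simp: A_def indicator_def)
      also have "\<dots> = - \<epsilon> * a (q y)" using S_fin elim by simp
      finally have "f (q y) \<le> (\<Sum>j\<in>S. indicator (A j) y * (- \<epsilon> * a j))"
        using f_le[OF elim] by simp
      moreover have "f y \<le> f (q y) + D * dist y (q y)"
        using lipschitz_onD[OF f_lip, of y "q y"] by (simp add: dist_real_def)
      moreover have "D * dist y (q y) \<le> D * \<delta>"
        using q(3)[of y] D(1) by (simp add: dist_commute)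
      ultimately show ?case by linarith
    qed
    show "integrable \<nu> (\<lambda>y. (\<Sum>j\<in>S. indicator (A j) y * (- \<epsilon> * a j)) + D * \<delta>)"
      using A_sets by (intro Bochner_Integration.integrable_add Bochner_Integration.integrable_sum
        integrable_mult_left) (auto simp: \<nu>.emeasure_eq_measure)
  qed fact
  also have "\<dots> = (\<Sum>j\<in>S. p j * (- \<epsilon> * a j)) + D * \<delta>"
    using A_sets space \<nu>.prob_space by (simp add: p_def \<nu>.emeasure_eq_measure)
  finally have f_int_le: "(\<integral>y. f y \<partial>\<nu>) \<le> (\<Sum>j\<in>S. p j * (- \<epsilon> * a j)) + D * \<delta>" .
  have Q_int: "(\<integral>x. \<phi> x \<partial>\<mu>) \<le> (\<integral>x. hopf_lax 1 f x \<partial>\<mu>)"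
    using \<phi>_le hopf_lax_continuous[OF compact f_cont, of 1]
    by (intro integral_mono integrable_continuous_compact_space[OF compact \<mu>] \<phi>_cont) auto
  define k where "k z = (\<Sum>j\<in>S. ennreal (s j (fst z) / p j) * indicator (A j) (snd z))" for z :: "'a \<times> 'a"
  define \<pi> where "\<pi> = density (\<mu> \<Otimes>\<^sub>M \<nu>) k"
  have sets_prod: "sets (\<mu> \<Otimes>\<^sub>M \<nu>) = sets (borel :: ('a \<times> 'a) measure)"
    using sets_borel_prod_compact_space[OF compact] sets_pair_measure_cong[OF \<mu>(2) \<nu>(2)] by simp
  have sets_\<pi>: "sets \<pi> = sets borel" by (simp add: \<pi>_def sets_prod)
  have [measurable]: "s j \<in> borel_measurable \<mu>" "A j \<in> sets \<nu>" for j
    unfolding meas_\<mu> using A_sets by auto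
  have k_meas [measurable]: "k \<in> borel_measurable (\<mu> \<Otimes>\<^sub>M \<nu>)"
    unfolding k_def by measurable
  have product_integral: "(\<integral>\<^sup>+z. k z * (u (fst z) * v (snd z)) \<partial>(\<mu> \<Otimes>\<^sub>M \<nu>))
      = (\<Sum>j\<in>S. (\<integral>\<^sup>+x. ennreal (s j x / p j) * u x \<partial>\<mu>) * (\<integral>\<^sup>+y. indicator (A j) y * v y \<partial>\<nu>))"
    if [measurable]: "u \<in> borel_measurable \<mu>" "v \<in> borel_measurable \<nu>" for u v
  proof -
    have "k z * (u (fst z) * v (snd z))
        = (\<Sum>j\<in>S. (ennreal (s j (fst z) / p j) * u (fst z)) * (indicator (A j) (snd z) * v (snd z)))" for z
      unfolding k_def sum_distrib_right by (intro sum.cong refl) (simp add: mult_ac)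
    then have "(\<integral>\<^sup>+z. k z * (u (fst z) * v (snd z)) \<partial>(\<mu> \<Otimes>\<^sub>M \<nu>))
        = (\<Sum>j\<in>S. \<integral>\<^sup>+z. (ennreal (s j (fst z) / p j) * u (fst z)) * (indicator (A j) (snd z) * v (snd z)) \<partial>(\<mu> \<Otimes>\<^sub>M \<nu>))"
      by (simp add: nn_integral_sum)
    also have "\<dots> = (\<Sum>j\<in>S. (\<integral>\<^sup>+x. ennreal (s j x / p j) * u x \<partial>\<mu>) * (\<integral>\<^sup>+y. indicator (A j) y * v y \<partial>\<nu>))"
      by (intro sum.cong refl nn_integral_pair_mult[where u="\<lambda>x. ennreal (s _ x / p _) * u x"
          and v="\<lambda>y. indicator (A _) y * v y"]) (auto intro: \<nu>.sigma_finite_measure_axioms)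
    finally show ?thesis .
  qed
  have s_p: "ennreal (s j x / p j) * ennreal (p j) = ennreal (s j x)" if "j \<in> S" for j x
    using p_pos[OF that] s_pos[of j x] by (simp flip: ennreal_mult)
  have nn_s: "(\<integral>\<^sup>+x. ennreal (s j x / p j) \<partial>\<mu>) = 1" if j: "j \<in> S" for j
  proof -
    have "(\<integral>\<^sup>+x. ennreal (s j x / p j) \<partial>\<mu>) = ennreal (\<integral>x. s j x / p j \<partial>\<mu>)"
      using s_integrable[of j] s_pos p_pos[OF j] by (intro nn_integral_eq_integral) (auto simp: less_imp_le)
    then show ?thesis using int_s[OF j] p_pos[OF j] by simp
  qed
  have proj_meas: "fst \<in> measurable \<pi> borel" "snd \<in> measurable \<pi> borel"
    unfolding measurable_cong_sets[OF sets_\<pi> refl]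
    by (auto intro!: borel_measurable_continuous_onI continuous_intros)
  have emeasure_\<pi>: "emeasure \<pi> X = (\<integral>\<^sup>+z. k z * indicator X z \<partial>(\<mu> \<Otimes>\<^sub>M \<nu>))" if "X \<in> sets \<pi>" for X
    using that unfolding \<pi>_def by (intro emeasure_density k_meas) simp
  have marginal_fst: "distr \<pi> borel fst = \<mu>"
  proof (rule measure_eqI)
    fix B assume "B \<in> sets (distr \<pi> borel fst)"
    then have B [measurable]: "B \<in> sets \<mu>" using \<mu>(2) by simp
    have B_borel: "B \<in> sets borel" using B \<mu>(2) by simp
    have "emeasure (distr \<pi> borel fst) B = (\<integral>\<^sup>+z. k z * indicator (fst -` B \<inter> space \<pi>) z \<partial>(\<mu> \<Otimes>\<^sub>M \<nu>))"
      unfolding emeasure_distr[OF proj_meas(1) B_borel]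
      by (rule emeasure_\<pi>[OF measurable_sets[OF proj_meas(1) B_borel]])
    also have "\<dots> = (\<integral>\<^sup>+z. k z * (indicator B (fst z) * (\<lambda>_. 1) (snd z)) \<partial>(\<mu> \<Otimes>\<^sub>M \<nu>))"
      by (intro nn_integral_cong) (auto simp: \<pi>_def indicator_def)
    also have "\<dots> = (\<Sum>j\<in>S. (\<integral>\<^sup>+x. ennreal (s j x / p j) * indicator B x \<partial>\<mu>) * (\<integral>\<^sup>+y. indicator (A j) y * 1 \<partial>\<nu>))"
      using B by (intro product_integral) auto
    also have "\<dots> = (\<Sum>j\<in>S. \<integral>\<^sup>+x. ennreal (s j x / p j) * ennreal (p j) * indicator B x \<partial>\<mu>)"
    proof (intro sum.cong refl)
      fix j
      have "(\<integral>\<^sup>+y. indicator (A j) y * 1 \<partial>\<nu>) = ennreal (p j)"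
        using A_sets[of j] by (simp add: p_emeasure)
      moreover have "(\<integral>\<^sup>+x. ennreal (s j x / p j) * indicator B x \<partial>\<mu>) * ennreal (p j)
          = (\<integral>\<^sup>+x. ennreal (s j x / p j) * indicator B x * ennreal (p j) \<partial>\<mu>)"
        by (rule nn_integral_multc[symmetric]) measurable
      ultimately show "(\<integral>\<^sup>+x. ennreal (s j x / p j) * indicator B x \<partial>\<mu>) * (\<integral>\<^sup>+y. indicator (A j) y * 1 \<partial>\<nu>)
          = (\<integral>\<^sup>+x. ennreal (s j x / p j) * ennreal (p j) * indicator B x \<partial>\<mu>)"
        by (simp add: mult_ac)
    qed
    also have "\<dots> = (\<integral>\<^sup>+x. (\<Sum>j\<in>S. ennreal (s j x / p j) * ennreal (p j) * indicator B x) \<partial>\<mu>)"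
      using B by (intro nn_integral_sum[symmetric]) auto
    also have "\<dots> = (\<integral>\<^sup>+x. indicator B x \<partial>\<mu>)"
    proof (rule nn_integral_cong)
      fix x
      have "(\<Sum>j\<in>S. ennreal (s j x / p j) * ennreal (p j) * indicator B x) = (\<Sum>j\<in>S. ennreal (s j x)) * indicator B x"
        unfolding sum_distrib_right by (intro sum.cong) (auto simp: s_p)
      also have "(\<Sum>j\<in>S. ennreal (s j x)) = 1"
        using s_pos s_sum[of x] by (subst sum_ennreal) (auto simp: less_imp_le)
      finally show "(\<Sum>j\<in>S. ennreal (s j x / p j) * ennreal (p j) * indicator B x) = indicator B x" by simp
    qed
    finally show "emeasure (distr \<pi> borel fst) B = emeasure \<mu> B" using B by simp
  qed (simp add: \<mu>)
  have marginal_snd: "distr \<pi> borel snd = \<nu>"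
  proof (rule measure_eqI)
    fix B assume "B \<in> sets (distr \<pi> borel snd)"
    then have B [measurable]: "B \<in> sets \<nu>" using \<nu>(2) by simp
    have B_borel: "B \<in> sets borel" using B \<nu>(2) by simp
    have "emeasure (distr \<pi> borel snd) B = (\<integral>\<^sup>+z. k z * indicator (snd -` B \<inter> space \<pi>) z \<partial>(\<mu> \<Otimes>\<^sub>M \<nu>))"
      unfolding emeasure_distr[OF proj_meas(2) B_borel]
      by (rule emeasure_\<pi>[OF measurable_sets[OF proj_meas(2) B_borel]])
    also have "\<dots> = (\<integral>\<^sup>+z. k z * ((\<lambda>_. 1) (fst z) * indicator B (snd z)) \<partial>(\<mu> \<Otimes>\<^sub>M \<nu>))"
      by (intro nn_integral_cong) (auto simp: \<pi>_def indicator_def)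
    also have "\<dots> = (\<Sum>j\<in>S. (\<integral>\<^sup>+x. ennreal (s j x / p j) * 1 \<partial>\<mu>) * (\<integral>\<^sup>+y. indicator (A j) y * indicator B y \<partial>\<nu>))"
      using B by (intro product_integral) auto
    also have "\<dots> = (\<Sum>j\<in>S. \<integral>\<^sup>+y. indicator (A j) y * indicator B y \<partial>\<nu>)"
      by (intro sum.cong) (auto simp: nn_s)
    also have "\<dots> = (\<integral>\<^sup>+y. (\<Sum>j\<in>S. indicator (A j) y * indicator B y) \<partial>\<nu>)"
      using B by (intro nn_integral_sum[symmetric]) auto
    also have "\<dots> = (\<integral>\<^sup>+y. indicator B y \<partial>\<nu>)"
    proof (rule nn_integral_cong_AE)
      show "AE y in \<nu>. (\<Sum>j\<in>S. indicator (A j) y * indicator B y) = (indicator B y :: ennreal)"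
        using AE_S
      proof eventually_elim
        case (elim y)
        have "(\<Sum>j\<in>S. indicator (A j) y * indicator B y) = (\<Sum>j\<in>S. if j = q y then indicator B y else (0::ennreal))"
          by (intro sum.cong) (auto simp: A_def indicator_def)
        then show ?case using S_fin elim by simp
      qed
    qed
    finally show "emeasure (distr \<pi> borel snd) B = emeasure \<nu> B" using B by simp
  qed (simp add: \<nu>)
  have "emeasure \<pi> (space \<pi>) = emeasure (distr \<pi> borel fst) UNIV"
    using proj_meas(1) by (subst emeasure_distr) auto
  also have "\<dots> = 1" unfolding marginal_fst using \<mu>.emeasure_space_1 space by simp
  finally have "prob_space \<pi>" by (rule prob_spaceI)
  then have coupling: "\<pi> \<in> couplings \<mu> \<nu>"
    using sets_\<pi> marginal_fst marginal_snd by (simp add: couplings_def)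
  have dist_meas: "(\<lambda>z. (dist (fst z) (snd z))\<^sup>2) \<in> borel_measurable (\<mu> \<Otimes>\<^sub>M \<nu>)"
    unfolding measurable_cong_sets[OF sets_prod refl]
    by (intro borel_measurable_continuous_onI continuous_intros)
  define c where "c j x = (dist x j)\<^sup>2 + 2 * D * \<delta>" for x j :: 'a
  have c_nonneg: "0 \<le> c j x" for j x using D(1) \<delta> by (simp add: c_def)
  have c_cont: "continuous_on UNIV (c j)" for j
    unfolding c_def[abs_def] by (intro continuous_intros)
  have [measurable]: "c j \<in> borel_measurable \<mu>" for j
    unfolding meas_\<mu> using c_cont by (rule borel_measurable_continuous_onI)
  have cost_bound: "(\<Sum>j\<in>S. s j x * c j x) \<le> 2 * (\<phi> x + \<epsilon> * (\<Sum>j\<in>S. a j * s j x) + \<epsilon> * n) + 2 * D * \<delta>" for x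
  proof -
    have "(\<Sum>j\<in>S. s j x * c j x) = (\<Sum>j\<in>S. 2 * (s j x * \<phi> x + \<epsilon> * (a j * s j x) + \<epsilon> * (- (s j x * ln (s j x)))) + 2 * D * \<delta> * s j x)"
    proof (rule sum.cong[OF refl])
      fix j
      have c_eq: "c j x = 2 * (\<phi> x + \<epsilon> * a j - \<epsilon> * ln (s j x)) + 2 * D * \<delta>"
        unfolding c_def cost_eq[symmetric] by simp
      show "s j x * c j x = 2 * (s j x * \<phi> x + \<epsilon> * (a j * s j x) + \<epsilon> * (- (s j x * ln (s j x)))) + 2 * D * \<delta> * s j x"
        unfolding c_eq by (simp add: algebra_simps)
    qed
    also have "\<dots> \<le> (\<Sum>j\<in>S. 2 * (s j x * \<phi> x + \<epsilon> * (a j * s j x) + \<epsilon> * 1) + 2 * D * \<delta> * s j x)"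
      using \<epsilon> s_pos by (intro sum_mono add_right_mono mult_left_mono add_left_mono neg_mult_ln_le_one) auto
    also have "\<dots> = 2 * ((\<Sum>j\<in>S. s j x) * \<phi> x + \<epsilon> * (\<Sum>j\<in>S. a j * s j x) + \<epsilon> * n) + 2 * D * \<delta> * (\<Sum>j\<in>S. s j x)"
      by (simp add: sum.distrib sum_distrib_left sum_distrib_right n_def algebra_simps)
    finally show ?thesis by (simp add: s_sum)
  qed
  have "(\<integral>\<^sup>+z. ennreal ((dist (fst z) (snd z))\<^sup>2) \<partial>\<pi>) = (\<integral>\<^sup>+z. k z * ennreal ((dist (fst z) (snd z))\<^sup>2) \<partial>(\<mu> \<Otimes>\<^sub>M \<nu>))"
    unfolding \<pi>_def using dist_meas by (subst nn_integral_density) auto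
  also have "\<dots> \<le> (\<integral>\<^sup>+z. (\<Sum>j\<in>S. (ennreal (s j (fst z) / p j) * ennreal (c j (fst z))) * indicator (A j) (snd z)) \<partial>(\<mu> \<Otimes>\<^sub>M \<nu>))"
  proof (rule nn_integral_mono)
    fix z
    have "ennreal (s j (fst z) / p j) * indicator (A j) (snd z) * ennreal ((dist (fst z) (snd z))\<^sup>2)
        \<le> ennreal (s j (fst z) / p j) * ennreal (c j (fst z)) * indicator (A j) (snd z)" for j
    proof (cases "snd z \<in> A j")
      case True
      let ?x = "fst z" and ?y = "snd z"
      have "q ?y = j" using True by (simp add: A_def)
      then have yj: "dist j ?y \<le> \<delta>" using q(3)[of ?y] by simp
      have "(dist ?x ?y)\<^sup>2 - (dist ?x j)\<^sup>2 = (dist ?x ?y - dist ?x j) * (dist ?x ?y + dist ?x j)"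
        by (simp add: power2_eq_square algebra_simps)
      also have "\<dots> \<le> \<delta> * (2 * D)"
        using yj dist_triangle[of ?x ?y j] D(2)[of ?x ?y] D(2)[of ?x j] \<delta> by (intro mult_mono) auto
      finally have "(dist ?x ?y)\<^sup>2 \<le> c j ?x" by (simp add: c_def mult_ac)
      then show ?thesis using True by (simp add: mult_left_mono ennreal_leI)
    qed simp
    then show "k z * ennreal ((dist (fst z) (snd z))\<^sup>2)
        \<le> (\<Sum>j\<in>S. (ennreal (s j (fst z) / p j) * ennreal (c j (fst z))) * indicator (A j) (snd z))"
      unfolding k_def sum_distrib_right by (intro sum_mono)
  qed
  also have "\<dots> = (\<Sum>j\<in>S. \<integral>\<^sup>+z. (ennreal (s j (fst z) / p j) * ennreal (c j (fst z))) * indicator (A j) (snd z) \<partial>(\<mu> \<Otimes>\<^sub>M \<nu>))"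
    by (intro nn_integral_sum) measurable
  also have "\<dots> = (\<Sum>j\<in>S. \<integral>\<^sup>+x. ennreal (s j x * c j x) \<partial>\<mu>)"
  proof (rule sum.cong[OF refl])
    fix j assume j: "j \<in> S"
    have "(\<integral>\<^sup>+z. (ennreal (s j (fst z) / p j) * ennreal (c j (fst z))) * indicator (A j) (snd z) \<partial>(\<mu> \<Otimes>\<^sub>M \<nu>))
        = (\<integral>\<^sup>+x. ennreal (s j x / p j) * ennreal (c j x) \<partial>\<mu>) * (\<integral>\<^sup>+y. indicator (A j) y \<partial>\<nu>)"
      by (rule nn_integral_pair_mult[where u="\<lambda>x. ennreal (s j x / p j) * ennreal (c j x)"])
         (auto intro: \<nu>.sigma_finite_measure_axioms)
    also have "\<dots> = (\<integral>\<^sup>+x. ennreal (s j x / p j) * ennreal (c j x) * ennreal (p j) \<partial>\<mu>)"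
      using A_sets[of j] by (simp add: p_emeasure nn_integral_multc)
    also have "\<dots> = (\<integral>\<^sup>+x. ennreal (s j x * c j x) \<partial>\<mu>)"
    proof (rule nn_integral_cong)
      fix x
      have "ennreal (s j x / p j) * ennreal (c j x) * ennreal (p j) = ennreal (s j x) * ennreal (c j x)"
        unfolding s_p[OF j, of x, symmetric] by (simp add: mult_ac)
      also have "\<dots> = ennreal (s j x * c j x)"
        using s_pos[of j x] c_nonneg[of j x] by (intro ennreal_mult[symmetric]) auto
      finally show "ennreal (s j x / p j) * ennreal (c j x) * ennreal (p j) = ennreal (s j x * c j x)" .
    qed
    finally show "(\<integral>\<^sup>+z. (ennreal (s j (fst z) / p j) * ennreal (c j (fst z))) * indicator (A j) (snd z) \<partial>(\<mu> \<Otimes>\<^sub>M \<nu>))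
        = (\<integral>\<^sup>+x. ennreal (s j x * c j x) \<partial>\<mu>)" .
  qed
  also have "\<dots> = (\<integral>\<^sup>+x. (\<Sum>j\<in>S. ennreal (s j x * c j x)) \<partial>\<mu>)"
    by (intro nn_integral_sum[symmetric]) measurable
  also have "\<dots> = (\<integral>\<^sup>+x. ennreal (\<Sum>j\<in>S. s j x * c j x) \<partial>\<mu>)"
    using s_pos c_nonneg by (intro nn_integral_cong sum_ennreal) (simp add: less_imp_le)
  also have "\<dots> = ennreal (\<integral>x. (\<Sum>j\<in>S. s j x * c j x) \<partial>\<mu>)"
    using s_pos c_nonneg s_cont c_cont
    by (intro nn_integral_eq_integral integrable_continuous_compact_space[OF compact \<mu>] continuous_intros)
       (auto intro!: sum_nonneg simp: less_imp_le)
  also have "\<dots> \<le> ennreal (\<integral>x. 2 * (\<phi> x + \<epsilon> * (\<Sum>j\<in>S. a j * s j x) + \<epsilon> * n) + 2 * D * \<delta> \<partial>\<mu>)"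
    by (intro ennreal_leI integral_mono cost_bound integrable_continuous_compact_space[OF compact \<mu>]
        continuous_intros s_cont c_cont \<phi>_cont)
  also have "(\<integral>x. 2 * (\<phi> x + \<epsilon> * (\<Sum>j\<in>S. a j * s j x) + \<epsilon> * n) + 2 * D * \<delta> \<partial>\<mu>)
      = 2 * ((\<integral>x. \<phi> x \<partial>\<mu>) + \<epsilon> * (\<Sum>j\<in>S. a j * p j) + \<epsilon> * n) + 2 * D * \<delta>"
    using s_integrable integrable_continuous_compact_space[OF compact \<mu> \<phi>_cont]
    by (simp add: int_s \<mu>.prob_space)
  also have "ennreal \<dots> \<le> ennreal (2 * ((\<integral>x. hopf_lax 1 f x \<partial>\<mu>) - (\<integral>x. f x \<partial>\<nu>)) + \<eta>)"
  proof (rule ennreal_leI)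
    have "(\<Sum>j\<in>S. p j * (- \<epsilon> * a j)) = - \<epsilon> * (\<Sum>j\<in>S. a j * p j)"
      unfolding sum_distrib_left by (intro sum.cong) auto
    moreover have "D * \<delta> = \<eta> / 8" "\<epsilon> * n = \<eta> / 4"
      using D(1) n by (simp_all add: \<delta>_def \<epsilon>_def)
    ultimately show "2 * ((\<integral>x. \<phi> x \<partial>\<mu>) + \<epsilon> * (\<Sum>j\<in>S. a j * p j) + \<epsilon> * n) + 2 * D * \<delta>
        \<le> 2 * ((\<integral>x. hopf_lax 1 f x \<partial>\<mu>) - (\<integral>x. f x \<partial>\<nu>)) + \<eta>"
      using Q_int f_int_le by simp
  qed
  finally show thesis
    using that[OF f_cont coupling] by blast
qed

section \<open>From the logarithmic Sobolev inequality to the Talagrand inequality\<close>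

text \<open>
  The Legendre duality between \<open>r ln r - r\<close> and \<open>exp\<close>; it gives the variational inequality for the
  entropy.
\<close>

lemma young_entropy:
  fixes r g :: real
  assumes "0 \<le> r"
  shows "r * g \<le> r * ln r - r + exp g"
proof (cases "r = 0")
  case False
  then have r: "0 < r" using assms by simp
  have "r * (1 + (g - ln r)) \<le> r * exp (g - ln r)"
    using r exp_ge_add_one_self[of "g - ln r"] by (intro mult_left_mono) auto
  also have "\<dots> = exp g" using r by (simp add: exp_diff)
  finally show ?thesis by (simp add: algebra_simps)
qed simp

lemma entropy_variational_le:
  fixes F g :: "'a \<Rightarrow> real"
  assumes prob: "prob_space \<nu>"
    and F: "integrable \<nu> (\<lambda>x. (F x)\<^sup>2)" "(\<integral>x. (F x)\<^sup>2 \<partial>\<nu>) = 1"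
    and ent: "integrable \<nu> (\<lambda>x. (F x)\<^sup>2 * ln ((F x)\<^sup>2))"
    and g: "g \<in> borel_measurable \<nu>" "\<And>x. \<bar>g x\<bar> \<le> B"
  shows "(\<integral>x. (F x)\<^sup>2 * g x \<partial>\<nu>) \<le> (\<integral>x. (F x)\<^sup>2 * ln ((F x)\<^sup>2) \<partial>\<nu>) + ln (\<integral>x. exp (g x) \<partial>\<nu>)"
proof -
  interpret prob_space \<nu> by fact
  define Z where "Z = (\<integral>x. exp (g x) \<partial>\<nu>)"
  have [measurable]: "g \<in> borel_measurable \<nu>" by fact
  have int_exp: "integrable \<nu> (\<lambda>x. exp (g x))" and Z: "0 < Z"
    unfolding Z_def using integral_exp_bounded[OF prob g] by auto
  have int_Fg: "integrable \<nu> (\<lambda>x. (F x)\<^sup>2 * g x)"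
  proof (rule Bochner_Integration.integrable_bound)
    show "integrable \<nu> (\<lambda>x. (F x)\<^sup>2 * B)" using F(1) by auto
    show "(\<lambda>x. (F x)\<^sup>2 * g x) \<in> borel_measurable \<nu>"
      using borel_measurable_integrable[OF F(1)] by measurable
    have "\<bar>g x\<bar> \<le> \<bar>B\<bar>" for x using g(2)[of x] by simp
    then show "AE x in \<nu>. norm ((F x)\<^sup>2 * g x) \<le> norm ((F x)\<^sup>2 * B)"
      by (auto simp: abs_mult intro!: mult_left_mono)
  qed
  have "(F x)\<^sup>2 * (g x - ln Z) \<le> (F x)\<^sup>2 * ln ((F x)\<^sup>2) - (F x)\<^sup>2 + exp (g x) / Z" for x
    using young_entropy[of "(F x)\<^sup>2" "g x - ln Z"] Z by (simp add: exp_diff)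
  then have "(\<integral>x. (F x)\<^sup>2 * g x - (F x)\<^sup>2 * ln Z \<partial>\<nu>)
      \<le> (\<integral>x. (F x)\<^sup>2 * ln ((F x)\<^sup>2) - (F x)\<^sup>2 + exp (g x) / Z \<partial>\<nu>)"
    using F(1) ent int_exp int_Fg by (intro integral_mono) (auto simp: right_diff_distrib)
  then show ?thesis
    using F ent int_exp int_Fg Z by (simp add: Z_def[symmetric])
qed

lemma W2_le_ext_sqrt_iff:
  fixes E K :: real
  assumes "0 \<le> E" "0 < K"
  shows "W\<^sub>2 \<mu> \<nu> \<le> ext_sqrt (2 * ereal E / ereal K) \<longleftrightarrow>
    (INF \<pi> \<in> couplings \<mu> \<nu>. \<integral>\<^sup>+z. ennreal ((dist (fst z) (snd z))\<^sup>2) \<partial>\<pi>) \<le> ennreal (2 * E / K)"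
proof -
  let ?I = "INF \<pi> \<in> couplings \<mu> \<nu>. \<integral>\<^sup>+z. ennreal ((dist (fst z) (snd z))\<^sup>2) \<partial>\<pi>"
  have rhs: "ext_sqrt (2 * ereal E / ereal K) = ereal (sqrt (2 * E / K))"
    using assms by (simp add: ext_sqrt_def)
  show ?thesis
  proof (cases ?I)
    case (real w)
    have "W\<^sub>2 \<mu> \<nu> = ereal (sqrt w)"
      unfolding W\<^sub>2_def real using real by (simp add: ext_sqrt_def enn2ereal_ennreal)
    then show ?thesis
      unfolding rhs real using real assms by (simp add: ennreal_le_iff)
  next
    case top
    have "W\<^sub>2 \<mu> \<nu> = \<infinity>"
      unfolding W\<^sub>2_def top by (simp add: ext_sqrt_def)
    then show ?thesis unfolding rhs top by (simp add: top_unique)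
  qed
qed

lemma prob_space_density_sq:
  fixes F :: "'a \<Rightarrow> real"
  assumes "(\<integral>x. (F x)\<^sup>2 \<partial>\<nu>) = 1" "integrable \<nu> (\<lambda>x. (F x)\<^sup>2)"
  shows "prob_space (density \<nu> (\<lambda>x. ennreal ((F x)\<^sup>2)))"
proof (rule prob_spaceI)
  have "emeasure (density \<nu> (\<lambda>x. ennreal ((F x)\<^sup>2))) (space \<nu>) = (\<integral>\<^sup>+x. ennreal ((F x)\<^sup>2) \<partial>\<nu>)"
    using borel_measurable_integrable[OF assms(2)]
    by (subst emeasure_density) (auto intro!: nn_integral_cong)
  also have "\<dots> = 1"
    using assms by (subst nn_integral_eq_integral) auto
  finally show "emeasure (density \<nu> (\<lambda>x. ennreal ((F x)\<^sup>2))) (space (density \<nu> (\<lambda>x. ennreal ((F x)\<^sup>2)))) = 1"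
    by simp
qed

lemma integral_density_sq:
  fixes F u :: "'a \<Rightarrow> real"
  assumes "F \<in> borel_measurable \<nu>" "u \<in> borel_measurable \<nu>"
  shows "(\<integral>x. u x \<partial>density \<nu> (\<lambda>x. ennreal ((F x)\<^sup>2))) = (\<integral>x. (F x)\<^sup>2 * u x \<partial>\<nu>)"
  using assms by (subst integral_density) auto

lemma ent_sq_eq_infinity:
  assumes prob: "prob_space \<nu>" and F: "F \<in> borel_measurable \<nu>"
    and not: "\<not> integrable \<nu> (\<lambda>x. (F x)\<^sup>2 * ln ((F x)\<^sup>2))"
  shows "ent_sq \<nu> F = \<infinity>"
proof -
  interpret prob_space \<nu> by fact
  let ?n = "\<integral>\<^sup>+x. ennreal (- ((F x)\<^sup>2 * ln ((F x)\<^sup>2))) \<partial>\<nu>"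
  have "- ((F x)\<^sup>2 * ln ((F x)\<^sup>2)) \<le> 1" for x
    using neg_mult_ln_le_one[of "(F x)\<^sup>2"] by (cases "F x = 0") auto
  then have "?n \<le> (\<integral>\<^sup>+x. 1 \<partial>\<nu>)"
    by (intro nn_integral_mono) (metis ennreal_1 ennreal_leI)
  then have n: "?n \<le> 1" by (simp add: emeasure_space_1)
  then have "?n \<noteq> \<infinity>" by (auto simp: top_unique)
  have meas: "(\<lambda>x. (F x)\<^sup>2 * ln ((F x)\<^sup>2)) \<in> borel_measurable \<nu>"
    using F by measurable
  have p: "(\<integral>\<^sup>+x. ennreal ((F x)\<^sup>2 * ln ((F x)\<^sup>2)) \<partial>\<nu>) = \<infinity>"
    using not meas \<open>?n \<noteq> \<infinity>\<close> unfolding real_integrable_def by auto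
  obtain r where r: "?n = ennreal r" "0 \<le> r" using \<open>?n \<noteq> \<infinity>\<close> by (cases ?n) auto
  show ?thesis
    unfolding ent_sq_def p r using r(2) by (simp add: enn2ereal_ennreal)
qed

text \<open>
  When the entropy is infinite there is nothing to prove. Otherwise every value
  \<open>\<integral> Q\<^sub>1 f d\<mu> - \<integral> f d\<nu>\<close> of the dual problem is at most \<open>E/K\<close>, by the variational inequality with
  \<open>g = K Q\<^sub>1 f\<close> and the exponential moment bound.
\<close>

lemma LSI_imp_Talagrand:
  fixes \<nu> :: "'a::metric_space measure"
  assumes compact: "compact (UNIV :: 'a set)" and prob: "prob_space \<nu>" and sets: "sets \<nu> = sets borel"
    and K: "0 < K" and LSI: "LSI \<nu> K"
  shows "Talagrand \<nu> K"
  unfolding Talagrand_def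
proof (intro allI impI, elim conjE)
  fix F :: "'a \<Rightarrow> real" assume F: "F \<in> borel_measurable \<nu>" "integrable \<nu> (\<lambda>x. (F x)\<^sup>2)" "(\<integral>x. (F x)\<^sup>2 \<partial>\<nu>) = 1"
  interpret prob_space \<nu> by fact
  define \<mu> where "\<mu> = density \<nu> (\<lambda>x. ennreal ((F x)\<^sup>2))"
  have \<mu>: "prob_space \<mu>" "sets \<mu> = sets borel"
    using prob_space_density_sq[OF F(3,2)] sets by (simp_all add: \<mu>_def)
  show "W\<^sub>2 \<mu> \<nu> \<le> ext_sqrt (2 * ent_sq \<nu> F / ereal K)"
  proof (cases "integrable \<nu> (\<lambda>x. (F x)\<^sup>2 * ln ((F x)\<^sup>2))")
    case False
    then show ?thesis
      using K by (simp add: ent_sq_eq_infinity[OF prob F(1)] ext_sqrt_def)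
  next
    case True
    define E where "E = (\<integral>x. (F x)\<^sup>2 * ln ((F x)\<^sup>2) \<partial>\<nu>)"
    note variational = entropy_variational_le[OF prob F(2,3) True, folded E_def]
    have E: "0 \<le> E"
      using variational[of "\<lambda>_. 0" 0] by (simp add: prob_space)
    have "(INF \<pi> \<in> couplings \<mu> \<nu>. \<integral>\<^sup>+z. ennreal ((dist (fst z) (snd z))\<^sup>2) \<partial>\<pi>) \<le> ennreal (2 * E / K)"
    proof (rule ennreal_le_epsilon)
      fix \<eta> :: real assume \<eta>: "0 < \<eta>"
      obtain f \<pi> where f: "continuous_on UNIV f" and \<pi>: "\<pi> \<in> couplings \<mu> \<nu>"
        and le: "(\<integral>\<^sup>+z. ennreal ((dist (fst z) (snd z))\<^sup>2) \<partial>\<pi>)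
          \<le> ennreal (2 * ((\<integral>x. hopf_lax 1 f x \<partial>\<mu>) - (\<integral>x. f x \<partial>\<nu>)) + \<eta>)"
        using kantorovich_duality_approx[OF compact \<mu> prob sets \<eta>] by blast
      obtain B where B: "\<And>x. \<bar>f x\<bar> \<le> B"
        using compact_space_continuous_bounded[OF compact f] by blast
      have Q_meas: "hopf_lax 1 f \<in> borel_measurable \<nu>"
        unfolding measurable_cong_sets[OF sets refl]
        using hopf_lax_continuous[OF compact f, of 1] by (intro borel_measurable_continuous_onI) auto
      have "K * (\<integral>x. hopf_lax 1 f x \<partial>\<mu>) = (\<integral>x. (F x)\<^sup>2 * (K * hopf_lax 1 f x) \<partial>\<nu>)"
        unfolding \<mu>_def integral_density_sq[OF F(1) Q_meas]
        by (simp add: mult.left_commute flip: integral_mult_right_zero)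
      also have "\<dots> \<le> E + ln (\<integral>x. exp (K * hopf_lax 1 f x) \<partial>\<nu>)"
        using Q_meas hopf_lax_bounded[OF compact f _ B, of 1] K
        by (intro variational[where B="K * B"]) (auto simp: abs_mult intro!: mult_left_mono)
      also have "\<dots> \<le> E + K * (\<integral>x. f x \<partial>\<nu>)"
        using LSI_imp_exponential_moment_bound[OF compact prob sets K LSI f] by simp
      finally have "(\<integral>x. hopf_lax 1 f x \<partial>\<mu>) - (\<integral>x. f x \<partial>\<nu>) \<le> E / K"
        using K by (simp add: field_simps)
      then have "ennreal (2 * ((\<integral>x. hopf_lax 1 f x \<partial>\<mu>) - (\<integral>x. f x \<partial>\<nu>)) + \<eta>) \<le> ennreal (2 * E / K + \<eta>)"
        by (intro ennreal_leI) simp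
      also have "\<dots> = ennreal (2 * E / K) + ennreal \<eta>"
        using E K \<eta> by (intro ennreal_plus) auto
      finally show "(INF \<pi> \<in> couplings \<mu> \<nu>. \<integral>\<^sup>+z. ennreal ((dist (fst z) (snd z))\<^sup>2) \<partial>\<pi>)
          \<le> ennreal (2 * E / K) + ennreal \<eta>"
        using le \<pi> by (intro INF_lower2[OF \<pi>]) auto
    qed
    then show ?thesis
      unfolding ent_sq_eq_integral[OF True] E_def[symmetric] using W2_le_ext_sqrt_iff[OF E K] by blast
  qed
qed

section \<open>From the Talagrand inequality to the Poincare inequality\<close>

text \<open>
  The sharp constant in the Poincare inequality requires the second-order term of the logarithm.
\<close>

lemma ln_one_plus_le_cubic:
  fixes t :: real
  assumes "- 1 < t"
  shows "ln (1 + t) \<le> t - t\<^sup>2 / 2 + t ^ 3 / 3"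
proof -
  define \<psi> where "\<psi> x = x - x\<^sup>2 / 2 + x ^ 3 / 3 - ln (1 + x)" for x :: real
  have deriv: "(\<psi> has_real_derivative x ^ 3 / (1 + x)) (at x)" if "- 1 < x" for x
  proof -
    have "(\<psi> has_real_derivative 1 - x + x\<^sup>2 - 1 / (1 + x)) (at x)"
      unfolding \<psi>_def[abs_def] using that
      by (auto intro!: derivative_eq_intros simp: power2_eq_square)
    moreover have "1 - x + x\<^sup>2 - 1 / (1 + x) = x ^ 3 / (1 + x)"
      using that by (simp add: field_simps power2_eq_square power3_eq_cube)
    ultimately show ?thesis by simp
  qed
  have "\<psi> 0 \<le> \<psi> t"
  proof (cases "0 \<le> t")
    case True
    show ?thesis
      using True by (rule DERIV_nonneg_imp_nondecreasing) (auto intro!: exI deriv)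
  next
    case False
    then have "t \<le> 0" by simp
    then show ?thesis
    proof (rule DERIV_nonpos_imp_nonincreasing)
      fix x assume x: "t \<le> x" "x \<le> 0"
      then have "x ^ 3 / (1 + x) \<le> 0"
        using assms by (intro divide_nonpos_pos) (auto simp: power3_eq_cube mult_nonneg_nonpos mult_nonpos_nonpos)
      then show "\<exists>y. (\<psi> has_real_derivative y) (at x) \<and> y \<le> 0"
        using deriv[of x] x assms by auto
    qed
  qed
  then show ?thesis by (simp add: \<psi>_def)
qed

lemma entropy_integrand_le_cubic:
  fixes t :: real
  assumes "\<bar>t\<bar> \<le> 1 / 2"
  shows "(1 + t) * ln (1 + t) \<le> t + t\<^sup>2 / 2 + \<bar>t\<bar> ^ 3"
proof -
  have "(1 + t) * ln (1 + t) \<le> (1 + t) * (t - t\<^sup>2 / 2 + t ^ 3 / 3)"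
    using assms by (intro mult_left_mono ln_one_plus_le_cubic) auto
  also have "\<dots> = t + t\<^sup>2 / 2 + (t ^ 4 / 3 - t ^ 3 / 6)"
    by (simp add: power2_eq_square power3_eq_cube power4_eq_xxxx field_simps)
  also have "t ^ 4 / 3 - t ^ 3 / 6 \<le> \<bar>t\<bar> ^ 3"
  proof -
    have "t ^ 4 = \<bar>t\<bar> * \<bar>t\<bar> ^ 3"
      by (simp add: power3_eq_cube power4_eq_xxxx flip: abs_mult)
    also have "\<dots> \<le> 1 * \<bar>t\<bar> ^ 3" using assms by (intro mult_right_mono) auto
    finally have "t ^ 4 \<le> \<bar>t\<bar> ^ 3" by simp
    moreover have "- (t ^ 3) \<le> \<bar>t\<bar> ^ 3" by (simp flip: power_abs)
    moreover have "0 \<le> \<bar>t\<bar> ^ 3" by simp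
    ultimately show ?thesis by linarith
  qed
  finally show ?thesis by simp
qed

lemma coupling_integrals:
  fixes u :: "'a::metric_space \<Rightarrow> real"
  assumes "\<pi> \<in> couplings \<mu> \<nu>" "u \<in> borel_measurable borel"
  shows "(\<integral>z. u (fst z) \<partial>\<pi>) = (\<integral>x. u x \<partial>\<mu>)" "(\<integral>z. u (snd z) \<partial>\<pi>) = (\<integral>x. u x \<partial>\<nu>)"
proof -
  have sets: "sets \<pi> = sets borel" and marginals: "distr \<pi> borel fst = \<mu>" "distr \<pi> borel snd = \<nu>"
    using assms by (auto simp: couplings_def)
  have "fst \<in> \<pi> \<rightarrow>\<^sub>M borel" "snd \<in> \<pi> \<rightarrow>\<^sub>M borel"
    unfolding measurable_cong_sets[OF sets refl]
    by (auto intro!: borel_measurable_continuous_onI continuous_intros)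
  then show "(\<integral>z. u (fst z) \<partial>\<pi>) = (\<integral>x. u x \<partial>\<mu>)" "(\<integral>z. u (snd z) \<partial>\<pi>) = (\<integral>x. u x \<partial>\<nu>)"
    using assms(2) by (auto simp: integral_distr simp flip: marginals)
qed

text \<open>
  With \<open>V = \<integral> h\<^sup>2 d\<nu>\<close>, the weights in \<open>G d \<le> \<epsilon>/(2K) G\<^sup>2 + K/(2\<epsilon>) d\<^sup>2\<close> are chosen so that the
  leading part \<open>\<epsilon>\<^sup>2 V/K\<close> of the transport cost contributes \<open>\<epsilon> V/2\<close>, half of the left-hand side
  \<open>\<epsilon> V\<close>.
\<close>

lemma Talagrand_imp_Poincare_at_scale:
  fixes \<nu> :: "'a::metric_space measure"
  assumes compact: "compact (UNIV :: 'a set)" and prob: "prob_space \<nu>" and sets: "sets \<nu> = sets borel"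
    and K: "0 < K" and T: "Talagrand \<nu> K"
    and h: "L-lipschitz_on UNIV h" "(\<integral>x. h x \<partial>\<nu>) = 0" and r: "0 < r"
  defines "G \<equiv> \<lambda>x. enn2real (descending_slope h r x)"
  shows "(\<integral>x. (h x)\<^sup>2 \<partial>\<nu>) \<le> 1 / K * (\<integral>x. (G x)\<^sup>2 \<partial>\<nu>)"
proof -
  interpret prob_space \<nu> by fact
  have L: "0 \<le> L" using h(1) by (rule lipschitz_on_nonneg)
  have h_cont: "continuous_on UNIV h" using h(1) by (rule lipschitz_on_continuous_on)
  obtain B where B: "0 < B" "\<And>x. \<bar>h x\<bar> \<le> B"
    using compact_space_continuous_bounded[OF compact h_cont] by blast
  obtain D where D: "\<And>x y::'a. dist x y \<le> D"
    using compact_space_dist_bounded[OF compact] by blast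
  have [measurable]: "h \<in> borel_measurable borel" "descending_slope h r \<in> borel_measurable borel"
    using h_cont by (auto intro: borel_measurable_continuous_onI descending_slope_measurable)
  have [measurable]: "G \<in> borel_measurable borel" unfolding G_def by measurable
  have slope_le: "descending_slope h r x \<le> ennreal L" for x
    using h(1) by (rule descending_slope_lipschitz)
  have slope: "descending_slope h r x = ennreal (G x)" for x
    unfolding G_def using le_less_trans[OF slope_le ennreal_less_top, of x] by (simp add: less_top)
  have G: "0 \<le> G x" "G x \<le> L" for x
    unfolding G_def using slope_le[of x] L by (auto intro: enn2real_leI)
  have int_h: "integrable \<nu> h" and int_h2: "integrable \<nu> (\<lambda>x. (h x)\<^sup>2)"
    by (auto intro!: integrable_continuous_compact_space[OF compact prob sets] continuous_intros h_cont)
  have int_G2: "integrable \<nu> (\<lambda>x. (G x)\<^sup>2)"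
    using G by (intro integrable_bounded_borel[OF prob sets, where B="L\<^sup>2"]) (auto intro: power_mono)
  have near: "h x - h y \<le> G x * dist x y" if "dist x y < r" for x y
  proof (cases "x = y")
    case False
    then have "ennreal (max (h x - h y) 0 / dist x y) \<le> descending_slope h r x"
      unfolding descending_slope_def using that by (intro SUP_upper) auto
    then have "max (h x - h y) 0 / dist x y \<le> G x"
      unfolding slope using G(1)[of x] by (simp add: ennreal_le_iff)
    then have "max (h x - h y) 0 \<le> G x * dist x y"
      using False by (simp add: divide_le_eq)
    then show ?thesis by simp
  qed simp
  define V where "V = (\<integral>x. (h x)\<^sup>2 \<partial>\<nu>)"
  have V: "0 \<le> V" by (simp add: V_def)
  define C where "C = 2 * B ^ 3 / K + 1"
  have C: "0 \<le> C" using B K by (simp add: C_def)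
  have "V / 2 \<le> 1 / (2 * K) * (\<integral>x. (G x)\<^sup>2 \<partial>\<nu>)"
  proof (rule le_if_le_plus_linear[of "min 1 (1 / (2 * B))" _ _ "1 / (2 * K) * (B * L\<^sup>2) + K * C / 2 + L / r * (V / K + C)"])
    fix \<epsilon> :: real assume \<epsilon>: "0 < \<epsilon>" "\<epsilon> < min 1 (1 / (2 * B))"
    have "\<epsilon> * B \<le> 1 / 2" using \<epsilon> B by (simp add: field_simps)
    have eps_h: "\<bar>\<epsilon> * h x\<bar> \<le> \<epsilon> * B" for x
      using B(2)[of x] \<epsilon>(1) by (simp add: abs_mult)
    have small: "\<bar>\<epsilon> * h x\<bar> \<le> 1 / 2" for x
      using eps_h[of x] \<open>\<epsilon> * B \<le> 1 / 2\<close> by linarith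
    define F where "F x = sqrt (1 + \<epsilon> * h x)" for x
    have F_sq: "(F x)\<^sup>2 = 1 + \<epsilon> * h x" for x
      using small[of x] by (simp add: F_def abs_le_iff)
    have F_cont: "continuous_on UNIV F"
      unfolding F_def[abs_def] by (intro continuous_intros h_cont)
    have F_meas: "F \<in> borel_measurable \<nu>"
      unfolding measurable_cong_sets[OF sets refl] using F_cont by (rule borel_measurable_continuous_onI)
    have F_int: "integrable \<nu> (\<lambda>x. (F x)\<^sup>2)" "(\<integral>x. (F x)\<^sup>2 \<partial>\<nu>) = 1"
      unfolding F_sq using int_h h(2) by (simp_all add: prob_space)
    have pos: "1 + \<epsilon> * h x \<noteq> 0" for x using small[of x] by auto
    have ent_int: "integrable \<nu> (\<lambda>x. (F x)\<^sup>2 * ln ((F x)\<^sup>2))"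
      unfolding F_sq using pos
      by (intro integrable_continuous_compact_space[OF compact prob sets] continuous_intros h_cont) auto
    define E where "E = (\<integral>x. (F x)\<^sup>2 * ln ((F x)\<^sup>2) \<partial>\<nu>)"
    have E: "0 \<le> E"
      using entropy_variational_le[OF prob F_int ent_int, of "\<lambda>_. 0" 0] by (simp add: E_def prob_space)
    have "E \<le> (\<integral>x. \<epsilon> * h x + \<epsilon>\<^sup>2 / 2 * (h x)\<^sup>2 + \<epsilon> ^ 3 * B ^ 3 \<partial>\<nu>)"
      unfolding E_def
    proof (rule integral_mono[OF ent_int])
      show "integrable \<nu> (\<lambda>x. \<epsilon> * h x + \<epsilon>\<^sup>2 / 2 * (h x)\<^sup>2 + \<epsilon> ^ 3 * B ^ 3)"
        using int_h int_h2 by auto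
      fix x
      have "\<bar>\<epsilon> * h x\<bar> ^ 3 \<le> (\<epsilon> * B) ^ 3"
        using eps_h by (rule power_mono) simp
      then show "(F x)\<^sup>2 * ln ((F x)\<^sup>2) \<le> \<epsilon> * h x + \<epsilon>\<^sup>2 / 2 * (h x)\<^sup>2 + \<epsilon> ^ 3 * B ^ 3"
        using entropy_integrand_le_cubic[OF small[of x]] unfolding F_sq by (simp add: power_mult_distrib)
    qed
    also have "\<dots> = \<epsilon>\<^sup>2 / 2 * V + \<epsilon> ^ 3 * B ^ 3"
      using int_h int_h2 h(2) by (simp add: V_def prob_space)
    finally have E_le: "E \<le> \<epsilon>\<^sup>2 / 2 * V + \<epsilon> ^ 3 * B ^ 3" .
    define \<mu> where "\<mu> = density \<nu> (\<lambda>x. ennreal ((F x)\<^sup>2))"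
    have "W\<^sub>2 \<mu> \<nu> \<le> ext_sqrt (2 * ereal E / ereal K)"
      using T F_meas F_int unfolding Talagrand_def \<mu>_def E_def ent_sq_eq_integral[OF ent_int, symmetric] by blast
    then have "(INF \<pi> \<in> couplings \<mu> \<nu>. \<integral>\<^sup>+z. ennreal ((dist (fst z) (snd z))\<^sup>2) \<partial>\<pi>) \<le> ennreal (2 * E / K)"
      using W2_le_ext_sqrt_iff[OF E K] by blast
    \<comment> \<open>A slack of third order makes room for a coupling that almost attains the infimum.\<close>
    also have "\<dots> < ennreal (2 * E / K + \<epsilon> ^ 3)"
      using E K \<epsilon> by (intro ennreal_lessI) (auto intro: add_nonneg_pos)
    finally obtain \<pi> where \<pi>: "\<pi> \<in> couplings \<mu> \<nu>"
      and cost: "(\<integral>\<^sup>+z. ennreal ((dist (fst z) (snd z))\<^sup>2) \<partial>\<pi>) < ennreal (2 * E / K + \<epsilon> ^ 3)"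
      unfolding INF_less_iff by blast
    have prob_\<pi>: "prob_space \<pi>" and sets_\<pi>: "sets \<pi> = sets borel"
      using \<pi> by (auto simp: couplings_def)
    have [measurable]: "fst \<in> (borel :: ('a \<times> 'a) measure) \<rightarrow>\<^sub>M borel" "snd \<in> (borel :: ('a \<times> 'a) measure) \<rightarrow>\<^sub>M borel"
      by (auto intro!: borel_measurable_continuous_onI continuous_intros)
    have int_d: "integrable \<pi> (\<lambda>z. (dist (fst z) (snd z))\<^sup>2)"
      using D by (intro integrable_bounded_borel[OF prob_\<pi> sets_\<pi>, where B="D\<^sup>2"])
        (auto intro!: borel_measurable_continuous_onI continuous_intros power_mono)
    define W where "W = (\<integral>z. (dist (fst z) (snd z))\<^sup>2 \<partial>\<pi>)"
    have "ennreal W < ennreal (2 * E / K + \<epsilon> ^ 3)"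
      using cost nn_integral_eq_integral[OF int_d] by (simp add: W_def)
    then have "W \<le> 2 * E / K + \<epsilon> ^ 3"
      by (meson ennreal_leI leD linear)
    also have "\<dots> \<le> 2 * (\<epsilon>\<^sup>2 / 2 * V + \<epsilon> ^ 3 * B ^ 3) / K + \<epsilon> ^ 3"
      using E_le K by (intro add_right_mono divide_right_mono mult_left_mono) auto
    also have "\<dots> = \<epsilon>\<^sup>2 * (V / K) + \<epsilon> ^ 3 * C"
      using K by (simp add: C_def field_simps)
    finally have W_le: "W \<le> \<epsilon>\<^sup>2 * (V / K) + \<epsilon> ^ 3 * C" .
    have int_\<pi>: "integrable \<pi> (\<lambda>z. h (fst z))" "integrable \<pi> (\<lambda>z. h (snd z))" "integrable \<pi> (\<lambda>z. (G (fst z))\<^sup>2)"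
      using B(2) G
      by (intro integrable_bounded_borel[OF prob_\<pi> sets_\<pi>, where B=B]
            integrable_bounded_borel[OF prob_\<pi> sets_\<pi>, where B="L\<^sup>2"]; auto intro: power_mono)+
    have "\<epsilon> * V = (\<integral>x. (F x)\<^sup>2 * h x \<partial>\<nu>) - (\<integral>x. h x \<partial>\<nu>)"
      unfolding F_sq using int_h int_h2 h(2) by (simp add: V_def distrib_right power2_eq_square mult.assoc)
    also have "(\<integral>x. (F x)\<^sup>2 * h x \<partial>\<nu>) = (\<integral>x. h x \<partial>\<mu>)"
      unfolding \<mu>_def by (intro integral_density_sq[symmetric] F_meas borel_measurable_integrable int_h)
    also have "(\<integral>x. h x \<partial>\<mu>) - (\<integral>x. h x \<partial>\<nu>) = (\<integral>z. h (fst z) - h (snd z) \<partial>\<pi>)"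
      using int_\<pi> coupling_integrals[OF \<pi>, of h] by simp
    also have "\<dots> \<le> (\<integral>z. \<epsilon> / (2 * K) * (G (fst z))\<^sup>2 + (K / (2 * \<epsilon>) + L / r) * (dist (fst z) (snd z))\<^sup>2 \<partial>\<pi>)"
    proof (rule integral_mono)
      show "integrable \<pi> (\<lambda>z. h (fst z) - h (snd z))" using int_\<pi> by auto
      show "integrable \<pi> (\<lambda>z. \<epsilon> / (2 * K) * (G (fst z))\<^sup>2 + (K / (2 * \<epsilon>) + L / r) * (dist (fst z) (snd z))\<^sup>2)"
        using int_\<pi> int_d by auto
      fix z :: "'a \<times> 'a"
      define d where "d = dist (fst z) (snd z)"
      have d: "0 \<le> d" by (simp add: d_def)
      show "h (fst z) - h (snd z)
          \<le> \<epsilon> / (2 * K) * (G (fst z))\<^sup>2 + (K / (2 * \<epsilon>) + L / r) * (dist (fst z) (snd z))\<^sup>2"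
        unfolding d_def[symmetric]
      proof (cases "d < r")
        case True
        have "h (fst z) - h (snd z) \<le> G (fst z) * d"
          using near[of "fst z" "snd z"] True by (simp add: d_def)
        also have "\<dots> \<le> \<epsilon> / (2 * K) * (G (fst z))\<^sup>2 + K / (2 * \<epsilon>) * d\<^sup>2"
        proof -
          have "0 \<le> (\<epsilon> * G (fst z) - K * d)\<^sup>2 / (2 * K * \<epsilon>)"
            using K \<epsilon> by simp
          also have "\<dots> = \<epsilon> / (2 * K) * (G (fst z))\<^sup>2 + K / (2 * \<epsilon>) * d\<^sup>2 - G (fst z) * d"
            using K \<epsilon> by (simp add: field_simps power2_eq_square)
          finally show ?thesis by simp
        qed
        also have "\<dots> \<le> \<epsilon> / (2 * K) * (G (fst z))\<^sup>2 + (K / (2 * \<epsilon>) + L / r) * d\<^sup>2"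
          using L r by (simp add: distrib_right)
        finally show "h (fst z) - h (snd z) \<le> \<epsilon> / (2 * K) * (G (fst z))\<^sup>2 + (K / (2 * \<epsilon>) + L / r) * d\<^sup>2" .
      next
        case False
        have "h (fst z) - h (snd z) \<le> L * d"
          using lipschitz_onD[OF h(1), of "fst z" "snd z"] by (simp add: dist_real_def d_def)
        also have "\<dots> \<le> L * d * (d / r)"
          using False L r d mult_left_mono[of 1 "d / r" "L * d"] by simp
        also have "\<dots> = L / r * d\<^sup>2" by (simp add: power2_eq_square)
        also have "\<dots> \<le> \<epsilon> / (2 * K) * (G (fst z))\<^sup>2 + (K / (2 * \<epsilon>) + L / r) * d\<^sup>2"
          using K \<epsilon> by (simp add: distrib_right)
        finally show "h (fst z) - h (snd z) \<le> \<epsilon> / (2 * K) * (G (fst z))\<^sup>2 + (K / (2 * \<epsilon>) + L / r) * d\<^sup>2" .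
      qed
    qed
    also have "\<dots> = \<epsilon> / (2 * K) * (\<integral>x. (G x)\<^sup>2 \<partial>\<mu>) + (K / (2 * \<epsilon>) + L / r) * W"
      using int_\<pi> int_d coupling_integrals(1)[OF \<pi>, of "\<lambda>x. (G x)\<^sup>2"] by (simp add: W_def)
    also have "(\<integral>x. (G x)\<^sup>2 \<partial>\<mu>) = (\<integral>x. (F x)\<^sup>2 * (G x)\<^sup>2 \<partial>\<nu>)"
      unfolding \<mu>_def by (intro integral_density_sq F_meas borel_measurable_integrable int_G2)
    also have "\<epsilon> / (2 * K) * (\<integral>x. (F x)\<^sup>2 * (G x)\<^sup>2 \<partial>\<nu>) + (K / (2 * \<epsilon>) + L / r) * W
        \<le> \<epsilon> / (2 * K) * ((\<integral>x. (G x)\<^sup>2 \<partial>\<nu>) + \<epsilon> * (B * L\<^sup>2))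
          + (K / (2 * \<epsilon>) + L / r) * (\<epsilon>\<^sup>2 * (V / K) + \<epsilon> ^ 3 * C)"
    proof (intro add_mono mult_left_mono W_le)
      have "(\<integral>x. (F x)\<^sup>2 * (G x)\<^sup>2 \<partial>\<nu>) \<le> (\<integral>x. (G x)\<^sup>2 + \<epsilon> * (B * L\<^sup>2) \<partial>\<nu>)"
      proof (rule integral_mono)
        have "(F x)\<^sup>2 * (G x)\<^sup>2 \<le> (1 + \<epsilon> * B) * L\<^sup>2" for x
          unfolding F_sq using G[of x] small[of x] B(2)[of x] B(1) \<epsilon>
          by (intro mult_mono power_mono) (auto simp: abs_le_iff)
        then show "integrable \<nu> (\<lambda>x. (F x)\<^sup>2 * (G x)\<^sup>2)"
          using borel_measurable_continuous_onI[OF F_cont]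
          by (intro integrable_bounded_borel[OF prob sets, where B="(1 + \<epsilon> * B) * L\<^sup>2"]) auto
        show "integrable \<nu> (\<lambda>x. (G x)\<^sup>2 + \<epsilon> * (B * L\<^sup>2))" using int_G2 by auto
        fix x
        have "h x * (G x)\<^sup>2 \<le> B * L\<^sup>2"
          using G[of x] B(1) B(2)[of x] by (intro mult_mono power_mono) auto
        then have "\<epsilon> * (h x * (G x)\<^sup>2) \<le> \<epsilon> * (B * L\<^sup>2)" using \<epsilon> by (intro mult_left_mono) auto
        then show "(F x)\<^sup>2 * (G x)\<^sup>2 \<le> (G x)\<^sup>2 + \<epsilon> * (B * L\<^sup>2)"
          unfolding F_sq by (simp add: distrib_right mult.assoc)
      qed
      also have "\<dots> = (\<integral>x. (G x)\<^sup>2 \<partial>\<nu>) + \<epsilon> * (B * L\<^sup>2)"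
        using int_G2 by (simp add: prob_space)
      finally show "(\<integral>x. (F x)\<^sup>2 * (G x)\<^sup>2 \<partial>\<nu>) \<le> (\<integral>x. (G x)\<^sup>2 \<partial>\<nu>) + \<epsilon> * (B * L\<^sup>2)" .
    qed (use K \<epsilon> L r in auto)
    also have "\<dots> = \<epsilon> * (1 / (2 * K) * (\<integral>x. (G x)\<^sup>2 \<partial>\<nu>) + V / 2
        + \<epsilon> * (1 / (2 * K) * (B * L\<^sup>2) + K * C / 2 + L / r * (V / K + \<epsilon> * C)))"
    proof -
      have "\<epsilon> / (2 * K) * (I + \<epsilon> * c) = \<epsilon> * (1 / (2 * K) * I) + \<epsilon> * (\<epsilon> * (1 / (2 * K) * c))" for I c
        by (simp add: distrib_left)
      moreover have "K / (2 * \<epsilon>) * (\<epsilon>\<^sup>2 * (V / K) + \<epsilon> ^ 3 * C) = \<epsilon> * (V / 2) + \<epsilon> * (\<epsilon> * (K * C / 2))"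
        using K \<epsilon>(1) by (simp add: power2_eq_square power3_eq_cube distrib_left)
      moreover have "L / r * (\<epsilon>\<^sup>2 * (V / K) + \<epsilon> ^ 3 * C) = \<epsilon> * (\<epsilon> * (L / r * (V / K + \<epsilon> * C)))"
        by (simp add: power2_eq_square power3_eq_cube distrib_left mult_ac)
      ultimately show ?thesis
        unfolding distrib_right[of "K / (2 * \<epsilon>)"] by (simp only: distrib_left add_ac)
    qed
    finally have "V \<le> 1 / (2 * K) * (\<integral>x. (G x)\<^sup>2 \<partial>\<nu>) + V / 2
        + \<epsilon> * (1 / (2 * K) * (B * L\<^sup>2) + K * C / 2 + L / r * (V / K + \<epsilon> * C))"
      using \<epsilon>(1) by (simp only: mult_le_cancel_left_pos)
    also have "\<dots> \<le> 1 / (2 * K) * (\<integral>x. (G x)\<^sup>2 \<partial>\<nu>) + V / 2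
        + \<epsilon> * (1 / (2 * K) * (B * L\<^sup>2) + K * C / 2 + L / r * (V / K + 1 * C))"
      using \<epsilon> L r C by (intro add_left_mono mult_left_mono mult_right_mono) auto
    finally show "V / 2 \<le> 1 / (2 * K) * (\<integral>x. (G x)\<^sup>2 \<partial>\<nu>)
        + \<epsilon> * (1 / (2 * K) * (B * L\<^sup>2) + K * C / 2 + L / r * (V / K + C))"
      unfolding mult_1_left by linarith
  qed (use B in auto)
  then show ?thesis using K by (simp add: V_def field_simps)
qed

lemma Talagrand_imp_Poincare:
  fixes \<nu> :: "'a::metric_space measure"
  assumes compact: "compact (UNIV :: 'a set)" and prob: "prob_space \<nu>" and sets: "sets \<nu> = sets borel"
    and K: "0 < K" and T: "Talagrand \<nu> K"
  shows "Poincare \<nu> K"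
  unfolding Poincare_def
proof (intro ballI impI)
  fix h :: "'a \<Rightarrow> real" assume "h \<in> Lip" and h0: "(\<integral>x. h x \<partial>\<nu>) = 0"
  then obtain L where h: "L-lipschitz_on UNIV h" by (auto simp: Lip_def)
  have L: "0 \<le> L" using h by (rule lipschitz_on_nonneg)
  have h_cont: "continuous_on UNIV h" using h by (rule lipschitz_on_continuous_on)
  define G where "G n x = enn2real (descending_slope h (1 / real (Suc n)) x)" for n x
  define g where "g x = enn2real (subgradient_norm h x)" for x
  have [measurable]: "descending_slope h r \<in> borel_measurable borel" "subgradient_norm h \<in> borel_measurable borel" for r
    using h_cont by (auto intro: descending_slope_measurable subgradient_norm_measurable)
  have meas: "G n \<in> borel_measurable borel" "g \<in> borel_measurable borel" for n
    unfolding G_def g_def by measurable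
  have G: "0 \<le> G n x" "G n x \<le> L" for n x
    unfolding G_def using descending_slope_lipschitz[OF h] L by (auto intro: enn2real_leI)
  have g: "0 \<le> g x" "g x \<le> L" for x
    unfolding g_def using subgradient_norm_lipschitz[OF h] L by (auto intro: enn2real_leI)
  have subgradient_eq: "subgradient_norm h x = ennreal (g x)" for x
    unfolding g_def by (rule subgradient_norm_eq_ennreal[OF h])
  have lim: "(\<lambda>n. G n x) \<longlonglongrightarrow> g x" for x
  proof -
    have "decseq (\<lambda>n. descending_slope h (1 / real (Suc n)) x)"
      unfolding decseq_def by (auto intro!: descending_slope_mono divide_left_mono)
    then have "(\<lambda>n. descending_slope h (1 / real (Suc n)) x) \<longlonglongrightarrow> subgradient_norm h x"
      unfolding subgradient_norm_eq_INF_sequence by (rule LIMSEQ_INF)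
    then have "(\<lambda>n. descending_slope h (1 / real (Suc n)) x) \<longlonglongrightarrow> ennreal (g x)"
      unfolding subgradient_eq .
    then show ?thesis
      unfolding G_def using g(1) by (rule tendsto_enn2real)
  qed
  have int_g: "integrable \<nu> (\<lambda>x. (g x)\<^sup>2)"
    using g meas by (intro integrable_bounded_borel[OF prob sets, where B="L\<^sup>2"]) (auto intro: power_mono)
  have "(\<lambda>n. \<integral>x. (G n x)\<^sup>2 \<partial>\<nu>) \<longlonglongrightarrow> (\<integral>x. (g x)\<^sup>2 \<partial>\<nu>)"
  proof (rule integral_dominated_convergence)
    show "integrable \<nu> (\<lambda>_. L\<^sup>2)"
      by (rule integrable_bounded_borel[OF prob sets, where B="L\<^sup>2"]) auto
    show "AE x in \<nu>. (\<lambda>n. (G n x)\<^sup>2) \<longlonglongrightarrow> (g x)\<^sup>2"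
      using lim by (auto intro!: tendsto_power)
    have "(G n x)\<^sup>2 \<le> L\<^sup>2" for n x
      using G by (intro power_mono)
    then show "AE x in \<nu>. norm ((G n x)\<^sup>2) \<le> L\<^sup>2" for n by simp
  qed (use meas in \<open>auto simp: measurable_cong_sets[OF sets refl]\<close>)
  then have "(\<lambda>n. 1 / K * (\<integral>x. (G n x)\<^sup>2 \<partial>\<nu>)) \<longlonglongrightarrow> 1 / K * (\<integral>x. (g x)\<^sup>2 \<partial>\<nu>)"
    by (rule tendsto_mult_left)
  then have le: "(\<integral>x. (h x)\<^sup>2 \<partial>\<nu>) \<le> 1 / K * (\<integral>x. (g x)\<^sup>2 \<partial>\<nu>)"
    by (rule tendsto_lowerbound)
       (auto simp: G_def intro!: always_eventually Talagrand_imp_Poincare_at_scale[OF compact prob sets K T h h0, simplified])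
  have "(\<integral>\<^sup>+x. (subgradient_norm h x)\<^sup>2 \<partial>\<nu>) = (\<integral>\<^sup>+x. ennreal ((g x)\<^sup>2) \<partial>\<nu>)"
    unfolding subgradient_eq using g(1) by (simp add: ennreal_power)
  also have "\<dots> = ennreal (\<integral>x. (g x)\<^sup>2 \<partial>\<nu>)"
    using int_g by (intro nn_integral_eq_integral) auto
  finally have nn: "(\<integral>\<^sup>+x. (subgradient_norm h x)\<^sup>2 \<partial>\<nu>) = ennreal (\<integral>x. (g x)\<^sup>2 \<partial>\<nu>)" .
  have "ennreal (1 / K) * (\<integral>\<^sup>+x. (subgradient_norm h x)\<^sup>2 \<partial>\<nu>) = ennreal (1 / K * (\<integral>x. (g x)\<^sup>2 \<partial>\<nu>))"
    unfolding nn using K by (intro ennreal_mult[symmetric]) auto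
  then show "ennreal (\<integral>x. (h x)\<^sup>2 \<partial>\<nu>) \<le> ennreal (1 / K) * (\<integral>\<^sup>+x. (subgradient_norm h x)\<^sup>2 \<partial>\<nu>)"
    using ennreal_leI[OF le] by (simp only:)
qed

theorem theorem1p8:
  fixes \<nu> :: "'a::metric_space measure" and K :: real
  assumes "compact (UNIV :: 'a set)"
    and "length_space (UNIV :: 'a set)"
    and "prob_space \<nu>"
    and "sets \<nu> = sets borel"
    and "K > 0"
  shows "(Talagrand \<nu> K \<longrightarrow> Poincare \<nu> K) \<and>
    (doubling \<nu> \<and> local_Poincare \<nu> \<longrightarrow> LSI \<nu> K \<longrightarrow> Talagrand \<nu> K)"
  using Talagrand_imp_Poincare[OF assms(1,3-5)] LSI_imp_Talagrand[OF assms(1,3-5)] by blast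

end
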